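(* Let $n\ge 2$. A function $\mathrm{Z}:\mathcal{P}(\mathbb{Z}^n)\to\mathbb{R}^n$ is an $\mathrm{SL}_n(\mathbb{Z})$ equivariant and translation covariant valuation if and only if there are $c_1,\dots,c_{n+1}\in\mathbb{R}$ such that $$\mathrm{Z}(P)=c_1\,\mathrm{L}^1_1(P)+\dots+c_{n+1}\,\mathrm{L}^1_{n+1}(P)$$ for every $P\in\mathcal{P}(\mathbb{Z}^n)$.
   Context: $\mathbb{N}$ is the set of non-negative integers. $\mathcal{P}(\mathbb{Z}^n)$ is the set of lattice polytopes in $\mathbb{R}^n$, i.e. convex polytopes with vertices in $\mathbb{Z}^n$ (the empty set is included). A function $\mathrm{Z}:\mathcal{P}(\mathbb{Z}^n)\to\mathbb{R}^n$ is: a valuation if $\mathrm{Z}(\emptyset)=0$ and $\mathrm{Z}(P)+\mathrm{Z}(Q)=\mathrm{Z}(P\cup Q)+\mathrm{Z}(P\cap Q)$ whenever $P,Q,P\cup Q,P\cap Q\in\mathcal{P}(\mathbb{Z}^n)$; $\mathrm{SL}_n(\mathbb{Z})$ equivariant if $\mathrm{Z}(\phi P)=\phi\,\mathrm{Z}(P)$ for all $\phi\in\mathrm{SL}_n(\mathbb{Z})$ (integer matrices of determinant $1$) and $P\in\mathcal{P}(\mathbb{Z}^n)$; translation covariant if there is a function $\mathrm{Z}^0:\mathcal{P}(\mathbb{Z}^n)\to\mathbb{R}$ such that $\mathrm{Z}(P+y)=\mathrm{Z}(P)+\mathrm{Z}^0(P)\,y$ for all $y\in\mathbb{Z}^n$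 and $P\in\mathcal{P}(\mathbb{Z}^n)$. The discrete moment vector is $\mathrm{L}^1(P)=\sum_{x\in P\cap\mathbb{Z}^n}x$. The functions $\mathrm{L}^1_i:\mathcal{P}(\mathbb{Z}^n)\to\mathbb{R}^n$, $i=1,\dots,n+1$, are the coefficients (which exist and are unique) in $\mathrm{L}^1(kP)=\sum_{i=1}^{n+1}\mathrm{L}^1_i(P)k^i$ for all $k\in\mathbb{N}$ and $P\in\mathcal{P}(\mathbb{Z}^n)$. *)

theory Defs
  imports "HOL-Analysis.Analysis"
begin

definition int_lattice :: "(real^'n) set" where
  "int_lattice = {x. \<forall>i. x $ i \<in> \<int>}"

text \<open>The empty set is a lattice polytope: it is a polytope without extreme points.\<close>

definition lattice_polytopes :: "(real^'n) set set" where
  "lattice_polytopes = {P. polytope P \<and> (\<forall>v. v extreme_point_of P \<longrightarrow> v \<in> int_lattice)}"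

definition SL_int :: "(real^'n^'n) set" where
  "SL_int = {A. (\<forall>i j. A $ i $ j \<in> \<int>) \<and> det A = 1}"

text \<open>
  A function on lattice polytopes is represented by a total function on sets; the properties below
  and the classification only involve its values on lattice polytopes.
\<close>

definition lattice_valuation :: "((real^'n) set \<Rightarrow> real^'n) \<Rightarrow> bool" where
  "lattice_valuation Z \<longleftrightarrow> Z {} = 0 \<and>
     (\<forall>P Q. P \<in> lattice_polytopes \<longrightarrow> Q \<in> lattice_polytopes \<longrightarrow>
        P \<union> Q \<in> lattice_polytopes \<longrightarrow> P \<inter> Q \<in> lattice_polytopes \<longrightarrow>
        Z P + Z Q = Z (P \<union> Q) + Z (P \<inter> Q))"

definition SL_int_equivariant :: "((real^'n) set \<Rightarrow> real^'n) \<Rightarrow> bool" where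
  "SL_int_equivariant Z \<longleftrightarrow>
     (\<forall>A\<in>SL_int. \<forall>P\<in>lattice_polytopes. Z ((\<lambda>x. A *v x) ` P) = A *v Z P)"

definition translation_covariant :: "((real^'n) set \<Rightarrow> real^'n) \<Rightarrow> bool" where
  "translation_covariant Z \<longleftrightarrow>
     (\<exists>Z0 :: (real^'n) set \<Rightarrow> real. \<forall>P\<in>lattice_polytopes. \<forall>y\<in>int_lattice.
        Z ((\<lambda>x. x + y) ` P) = Z P + Z0 P *\<^sub>R y)"

definition discrete_moment :: "(real^'n) set \<Rightarrow> real^'n" where
  "discrete_moment P = (\<Sum>x\<in>P \<inter> int_lattice. x)"

text \<open>
  The coefficient of \<open>k ^ i\<close> in the vector-valued polynomial \<open>k \<mapsto> discrete_moment (k P)\<close>, which has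
  no constant term and degree at most \<open>CARD('n) + 1\<close>. It is meaningful for lattice polytopes \<open>P\<close> and
  \<open>1 \<le> i \<le> CARD('n) + 1\<close>, where the description below is satisfied by exactly one vector.
\<close>

definition discrete_moment_coeff :: "nat \<Rightarrow> (real^'n) set \<Rightarrow> real^'n" where
  "discrete_moment_coeff i P = (THE v. \<exists>c :: nat \<Rightarrow> real^'n.
     (\<forall>k::nat. discrete_moment ((\<lambda>x. real k *\<^sub>R x) ` P)
        = (\<Sum>j = 1..CARD('n) + 1. (real k ^ j) *\<^sub>R c j)) \<and> v = c i)"

end

theory Submission
  imports Defs "HOL-Computational_Algebra.Polynomial"
begin

text \<open>
  The key point is that a valuation \<open>Z\<close> on lattice polytopes which vanishes on all faces of unimodular
  simplices is zero. For a point \<open>b\<close> on a segment \<open>[a, c]\<close> the hulls of \<open>K \<union> {a, b}\<close> and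
  \<open>K \<union> {b, c}\<close> have the hulls of \<open>K \<union> {a, c}\<close> and \<open>K \<union> {b}\<close> as union and intersection. Writing
  products for hulls of unions, this says \<open>(a - b)(c - b) = 0\<close> in an algebra generated by idempotents.
  From it one deduces \<open>(1 - a\<^sub>1)\<dots>(1 - a\<^sub>p) K = 0\<close> whenever a rational convex combination of the
  \<open>a\<^sub>i\<close> with positive coefficients lies in the hull of \<open>K\<close>, by induction on \<open>p\<close>: after
  replacing \<open>a\<^sub>1, a\<^sub>2\<close> by lattice points further away from \<open>a\<^sub>3\<close>, the segment between them
  contains a lattice point that can take over the role of both. Hence \<open>Z\<close> is determined by its values
  on simplices. A simplex of normalized volume greater than one has a lattice point all of whose
  barycentric coordinates are less than one in absolute value; exchanging a vertex for it decreases the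
  volume, and the relations above express \<open>Z\<close> of the simplex in terms of such smaller simplices.

  An equivariant \<open>Z\<close> with covariance function \<open>Z\<^sup>0\<close> takes the value \<open>Z\<^sup>0(T)\<close> times the centroid on
  each standard simplex \<open>T\<close>, because the symmetries of \<open>T\<close> leave no other choice. So \<open>Z\<close> is
  determined by the \<open>n + 1\<close> numbers \<open>Z\<^sup>0(T\<^sub>0), \<dots>, Z\<^sup>0(T\<^sub>n)\<close>. For the moment vector of \<open>k P\<close> these
  are \<open>k\<close> times \<open>k + i\<close> choose \<open>i\<close>, polynomials in \<open>k\<close> of degree \<open>i + 1\<close>; this gives both the
  polynomiality in \<open>k\<close> for all \<open>P\<close> and, by triangularity, coefficients \<open>c\<^sub>i\<close> for any given \<open>Z\<close>.
\<close>

section \<open>Lattice polytopes\<close>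

lemma int_lattice_0 [simp]: "0 \<in> int_lattice"
  by (simp add: int_lattice_def)

lemma int_lattice_add: "x \<in> int_lattice \<Longrightarrow> y \<in> int_lattice \<Longrightarrow> x + y \<in> int_lattice"
  by (simp add: int_lattice_def)

lemma int_lattice_diff: "x \<in> int_lattice \<Longrightarrow> y \<in> int_lattice \<Longrightarrow> x - y \<in> int_lattice"
  by (simp add: int_lattice_def)

lemma int_lattice_scaleR: "m \<in> \<int> \<Longrightarrow> x \<in> int_lattice \<Longrightarrow> m *\<^sub>R x \<in> int_lattice"
  by (simp add: int_lattice_def)

lemma int_lattice_sum: "(\<And>i. i \<in> A \<Longrightarrow> f i \<in> int_lattice) \<Longrightarrow> sum f A \<in> int_lattice"
  by (simp add: int_lattice_def Ints_sum)

lemma int_lattice_axis [simp]: "axis i 1 \<in> int_lattice"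
  by (simp add: int_lattice_def axis_def)

lemma convex_hull_lattice_polytope:
  assumes "finite K" "K \<subseteq> int_lattice"
  shows "convex hull K \<in> lattice_polytopes"
  unfolding lattice_polytopes_def polytope_def
  using assms extreme_point_of_convex_hull by blast

lemma lattice_polytope_convex_hull:
  assumes "P \<in> lattice_polytopes"
  obtains K where "finite K" "K \<subseteq> int_lattice" "P = convex hull K"
proof -
  have P: "polytope P" and ex: "{v. v extreme_point_of P} \<subseteq> int_lattice"
    using assms by (auto simp: lattice_polytopes_def)
  have "P = convex hull {v. v extreme_point_of P}"
    using P by (simp add: Krein_Milman_Minkowski polytope_imp_compact polytope_imp_convex)
  moreover have "finite {v. v extreme_point_of P}"
    using P by (simp add: finite_polyhedron_extreme_points polytope_imp_polyhedron)
  ultimately show thesis using ex that by blast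
qed

text \<open>The part of a convex combination carried by \<open>a\<close> and \<open>c\<close> can be
  rewritten with \<open>a\<close> and \<open>b\<close>, or with \<open>b\<close> and
  \<open>c\<close>, depending on its side of \<open>b\<close>; this gives the union. For the
  intersection, two representations of a common point are averaged so that \<open>a\<close> and
  \<open>c\<close> merge into \<open>b\<close>, which already lies in \<open>S\<close>.\<close>

lemma convex_hull_segment_split:
  fixes S :: "'a::real_vector set"
  assumes "convex S" "b \<in> S" "b \<in> closed_segment a c"
  shows "convex hull insert a (insert c S) = convex hull insert a S \<union> convex hull insert c S"
    and "convex hull insert a S \<inter> convex hull insert c S = S"
proof -
  obtain t where t: "0 \<le> t" "t \<le> 1" and b: "b = (1 - t) *\<^sub>R a + t *\<^sub>R c"
    using assms(3) by (auto simp: closed_segment_def)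
  have S: "convex hull S = S" "S \<noteq> {}" using assms by (auto simp: hull_same)
  have mem: "x \<in> convex hull insert d S \<longleftrightarrow> (\<exists>u s. 0 \<le> u \<and> u \<le> 1 \<and> s \<in> S \<and> x = u *\<^sub>R d + (1 - u) *\<^sub>R s)"
    for x d
    unfolding convex_hull_insert[OF S(2)] S(1)
  proof (intro iffI; clarsimp)
    fix u v :: real and s :: 'a assume "0 \<le> u" "0 \<le> v" "u + v = 1" "s \<in> S"
    then have "v = 1 - u" "0 \<le> u" "u \<le> 1" "s \<in> S" by auto
    then show "\<exists>u'\<ge>0. u' \<le> 1 \<and> (\<exists>s'. s' \<in> S \<and> u *\<^sub>R d + v *\<^sub>R s = u' *\<^sub>R d + (1 - u') *\<^sub>R s')"
      by blast
  next
    fix u :: real and s :: 'a assume "0 \<le> u" "u \<le> 1" "s \<in> S"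
    then show "\<exists>u'\<ge>0. \<exists>v\<ge>0. u' + v = 1 \<and> (\<exists>b. b \<in> S \<and> u *\<^sub>R d + (1 - u) *\<^sub>R s = u' *\<^sub>R d + v *\<^sub>R b)"
      by (metis add_diff_cancel_left' diff_add_cancel add.commute diff_ge_0_iff_ge)
  qed
  show "convex hull insert a S \<inter> convex hull insert c S = S"
  proof (intro equalityI subsetI)
    fix x assume "x \<in> convex hull insert a S \<inter> convex hull insert c S"
    then obtain v p w q where v: "0 \<le> v" "v \<le> 1" "p \<in> S" "x = v *\<^sub>R a + (1 - v) *\<^sub>R p"
      and w: "0 \<le> w" "w \<le> 1" "q \<in> S" "x = w *\<^sub>R c + (1 - w) *\<^sub>R q"
      unfolding Int_iff mem by blast
    show "x \<in> S"
    proof (cases "v = 0 \<or> w = 0")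
      case True then show ?thesis using v w by auto
    next
      case False
      \<comment> \<open>Weighting the two representations of \<open>x\<close> by \<theta> and 1 -
        \<theta> puts the coefficients of \<open>a\<close> and \<open>c\<close> in the ratio 1 - t
        to t, so together they form a multiple of \<open>b\<close>; \<open>d\<close> normalizes
        these weights.\<close>
      define d where "d = w * (1 - t) + v * t"
      have vw: "v > 0" "w > 0" using False v w by auto
      have d: "d > 0"
      proof (cases "t = 0")
        case False then show ?thesis using vw t unfolding d_def
          by (intro add_nonneg_pos mult_pos_pos mult_nonneg_nonneg) auto
      qed (use vw in \<open>auto simp: d_def\<close>)
      define \<theta> where "\<theta> = w * (1 - t) / d"
      have 1: "1 - \<theta> = v * t / d" using d by (simp add: \<theta>_def field_simps) (simp add: d_def algebra_simps)
      have th: "0 \<le> \<theta>" "0 \<le> 1 - \<theta>"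
        unfolding 1 using vw t d by (auto simp: \<theta>_def)
      have "x = \<theta> *\<^sub>R x + (1 - \<theta>) *\<^sub>R x" by (simp add: algebra_simps)
      also have "\<dots> = \<theta> *\<^sub>R (v *\<^sub>R a + (1 - v) *\<^sub>R p) + (1 - \<theta>) *\<^sub>R (w *\<^sub>R c + (1 - w) *\<^sub>R q)"
        using v w by metis
      also have "\<dots> = (\<theta> * v) *\<^sub>R a + ((1 - \<theta>) * w) *\<^sub>R c + (\<theta> * (1 - v)) *\<^sub>R p + ((1 - \<theta>) * (1 - w)) *\<^sub>R q"
        by (simp add: scaleR_add_right)
      also have "(\<theta> * v) *\<^sub>R a + ((1 - \<theta>) * w) *\<^sub>R c = (v * w / d) *\<^sub>R b"
        unfolding b 1 unfolding \<theta>_def by (simp add: scaleR_add_right mult_ac)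
      finally have x: "x = (v * w / d) *\<^sub>R b + (\<theta> * (1 - v)) *\<^sub>R p + ((1 - \<theta>) * (1 - w)) *\<^sub>R q" .
      have "(v * w / d) = \<theta> * v + (1 - \<theta>) * w"
        unfolding 1 unfolding \<theta>_def using d by (simp add: field_simps)
      then have s1: "v * w / d + \<theta> * (1 - v) + (1 - \<theta>) * (1 - w) = 1"
        by (simp add: algebra_simps)
      have "x \<in> convex hull {b, p, q}"
        unfolding x convex_hull_3 mem_Collect_eq
        using s1 vw d th v w
        by (intro exI[of _ "v * w / d"] exI[of _ "\<theta> * (1 - v)"] exI[of _ "(1 - \<theta>) * (1 - w)"]) auto
      also have "\<dots> \<subseteq> S" using assms v w by (intro hull_minimal) auto
      finally show ?thesis .
    qed
  next
    fix x assume "x \<in> S"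
    then show "x \<in> convex hull insert a S \<inter> convex hull insert c S" by (auto intro: hull_inc)
  qed
  show "convex hull insert a (insert c S) = convex hull insert a S \<union> convex hull insert c S"
  proof (intro equalityI subsetI)
    fix x assume "x \<in> convex hull insert a (insert c S)"
    then obtain u v s' where uv: "0 \<le> u" "0 \<le> v" "u + v = 1" "s' \<in> convex hull insert c S" "x = u *\<^sub>R a + v *\<^sub>R s'"
      by (subst (asm) convex_hull_insert) auto
    then obtain w s where w: "0 \<le> w" "w \<le> 1" "s \<in> S" "s' = w *\<^sub>R c + (1 - w) *\<^sub>R s"
      unfolding mem by blast
    define \<beta> where "\<beta> = v * w"
    have \<beta>: "0 \<le> \<beta>" "\<beta> \<le> v" using uv w by (auto simp: \<beta>_def mult_left_le)
    have x: "x = u *\<^sub>R a + \<beta> *\<^sub>R c + (v - \<beta>) *\<^sub>R s"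
      using uv w by (simp add: \<beta>_def scaleR_add_right algebra_simps)
    have v: "v = 1 - u" using uv by simp
    have comb: "p *\<^sub>R d + q *\<^sub>R b + r *\<^sub>R s \<in> convex hull insert d S" if "p \<ge> 0" "q \<ge> 0" "r \<ge> 0" "p + q + r = 1" for p q r d
    proof -
      have "p *\<^sub>R d + q *\<^sub>R b + r *\<^sub>R s \<in> convex hull {d, b, s}"
        unfolding convex_hull_3 using that by blast
      moreover have "{d, b, s} \<subseteq> insert d S" using assms w by auto
      ultimately show ?thesis using hull_mono by blast
    qed
    show "x \<in> convex hull insert a S \<union> convex hull insert c S"
    \<comment> \<open>The second condition places the part on \<open>a\<close> and \<open>c\<close>
      on the side of \<open>a\<close>: eliminating \<open>c\<close> through \<open>b\<close> leaves
      \<open>a\<close> with the coefficient \<open>u - \<beta> * (1 - t) / t\<close>.\<close>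
    proof (cases "t > 0 \<and> \<beta> * (1 - t) \<le> u * t")
      case True
      have "x = (u - \<beta> * (1 - t) / t) *\<^sub>R a + (\<beta> / t) *\<^sub>R b + (v - \<beta>) *\<^sub>R s"
      proof -
        have "(\<beta> / t) *\<^sub>R b = (\<beta> * (1 - t) / t) *\<^sub>R a + \<beta> *\<^sub>R c"
          unfolding b using True by (simp add: scaleR_add_right)
        then show ?thesis unfolding x by (simp add: scaleR_diff_left)
      qed
      moreover have "u - \<beta> * (1 - t) / t \<ge> 0" "\<beta> / t \<ge> 0" "u - \<beta> * (1 - t) / t + \<beta> / t + (v - \<beta>) = 1"
        using True \<beta> unfolding v by (auto simp: field_simps)
      ultimately show ?thesis using comb[of "u - \<beta> * (1 - t) / t" "\<beta> / t" "v - \<beta>" a] \<beta> by simp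
    next
      case False
      then have t1: "u * t \<le> \<beta> * (1 - t)" using t \<beta> by auto
      have "t < 1 \<or> u = 0" using t1 t uv by (cases "t = 1") auto
      then show ?thesis
      proof
        assume "t < 1"
        have *: "(\<beta> - u * t / (1 - t)) *\<^sub>R c + (u / (1 - t)) *\<^sub>R b = u *\<^sub>R a + \<beta> *\<^sub>R c"
        proof -
          have "(u / (1 - t)) *\<^sub>R b = u *\<^sub>R a + (u * t / (1 - t)) *\<^sub>R c"
            unfolding b using \<open>t < 1\<close> by (simp add: scaleR_add_right)
          then show ?thesis by (simp add: scaleR_diff_left)
        qed
        have "x = (\<beta> - u * t / (1 - t)) *\<^sub>R c + (u / (1 - t)) *\<^sub>R b + (v - \<beta>) *\<^sub>R s"
          unfolding x * ..
        moreover have "\<beta> - u * t / (1 - t) \<ge> 0" "u / (1 - t) \<ge> 0"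
          using t1 \<open>t < 1\<close> uv by (auto simp: field_simps)
        moreover have "u / (1 - t) = u + u * t / (1 - t)" using \<open>t < 1\<close> by (simp add: field_simps)
        ultimately show ?thesis using comb[of "\<beta> - u * t / (1 - t)" "u / (1 - t)" "v - \<beta>" c] \<beta> v by simp
      next
        assume "u = 0"
        then show ?thesis using comb[of \<beta> 0 "v - \<beta>" c] \<beta> v x by simp
      qed
    qed
  next
    fix x assume "x \<in> convex hull insert a S \<union> convex hull insert c S"
    then show "x \<in> convex hull insert a (insert c S)"
      using hull_mono[of "insert a S" "insert a (insert c S)"] hull_mono[of "insert c S" "insert a (insert c S)"]
      by blast
  qed
qed

section \<open>Circuit relations for valuations on lattice polytopes\<close>

text \<open>The reduction to unimodular simplices uses no symmetry of \<open>Z\<close>, so the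
  values may lie in any real vector space.\<close>

locale weak_valuation =
  fixes Z :: "(real^'n) set \<Rightarrow> 'b::real_vector"
  assumes empty: "Z {} = 0"
    and union_inter: "\<And>P Q. \<lbrakk>P \<in> lattice_polytopes; Q \<in> lattice_polytopes; P \<union> Q \<in> lattice_polytopes;
      P \<inter> Q \<in> lattice_polytopes\<rbrakk> \<Longrightarrow> Z P + Z Q = Z (P \<union> Q) + Z (P \<inter> Q)"
begin

text \<open>In the product notation of the overview this is \<open>Z\<close> applied to (1 -
  a_1)...(1 - a_p) K.\<close>

primrec alt_sum :: "(real^'n) list \<Rightarrow> (real^'n) set \<Rightarrow> 'b" where
  "alt_sum [] K = Z (convex hull K)"
| "alt_sum (a # as) K = alt_sum as K - alt_sum as (insert a K)"

lemma alt_sum_hull_cong: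
  "convex hull K = convex hull K' \<Longrightarrow> alt_sum as K = alt_sum as K'"
proof (induction as arbitrary: K K')
  case (Cons a as)
  have "convex hull insert a K = convex hull insert a K'"
    by (metis Cons.prems hull_insert)
  then show ?case using Cons by (metis alt_sum.simps(2))
qed simp

lemma alt_sum_mem_hull: "a \<in> convex hull K \<Longrightarrow> alt_sum (a # as) K = 0"
  using alt_sum_hull_cong[of K "insert a K" as] by (simp add: hull_redundant)

text \<open>Without further factors this is the valuation property for the splitting above. Each
  further factor only enlarges \<open>K\<close>, whose hull then still contains
  \<open>b\<close>.\<close>

lemma alt_sum_segment:
  assumes "finite K" "K \<subseteq> int_lattice" "a \<in> int_lattice" "c \<in> int_lattice" "set as \<subseteq> int_lattice"
    and "b \<in> closed_segment a c" "b \<in> convex hull K"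
  shows "alt_sum (a # c # as) K = 0"
  using assms
proof (induction as arbitrary: K)
  case Nil
  let ?S = "convex hull K"
  have h: "convex hull insert d ?S = convex hull insert d K" for d by (metis hull_insert)
  have h2: "convex hull insert a (insert c ?S) = convex hull insert a (insert c K)"
    by (metis hull_insert)
  note split = convex_hull_segment_split[OF convex_convex_hull Nil.prems(7,6), unfolded h h2]
  have lp: "convex hull insert a K \<in> lattice_polytopes" "convex hull insert c K \<in> lattice_polytopes"
    "convex hull K \<in> lattice_polytopes" "convex hull insert a (insert c K) \<in> lattice_polytopes"
    using Nil.prems by (auto intro!: convex_hull_lattice_polytope)
  have "Z (convex hull insert a K) + Z (convex hull insert c K)
      = Z (convex hull insert a K \<union> convex hull insert c K) + Z (convex hull insert a K \<inter> convex hull insert c K)"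
    by (rule union_inter) (use lp split in simp_all)
  then show ?case unfolding split(2) by (simp add: split(1) insert_commute algebra_simps)
next
  case (Cons d as)
  have "b \<in> convex hull insert d K" using Cons.prems hull_mono[of K "insert d K"] by blast
  then have "alt_sum (a # c # as) (insert d K) = 0" "alt_sum (a # c # as) K = 0"
    using Cons by auto
  then show ?case by (simp add: insert_commute algebra_simps)
qed

section \<open>Alternating sums over balanced weighted points\<close>

definition weight :: "(real \<times> (real^'n)) list \<Rightarrow> real" where
  "weight L = sum_list (map fst L)"

definition moment :: "(real \<times> (real^'n)) list \<Rightarrow> real^'n" where
  "moment L = sum_list (map (\<lambda>(w, x). w *\<^sub>R x) L)"

text \<open>The barycentre of the weighted points lies in the hull of \<open>K\<close>. Integral
  weights represent rational coefficients with cleared denominators, and they keep the points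
  constructed below in the lattice.\<close>

definition balanced :: "(real \<times> (real^'n)) list \<Rightarrow> (real^'n) set \<Rightarrow> bool" where
  "balanced L K \<longleftrightarrow> (\<forall>(w, x)\<in>set L. w > 0 \<and> w \<in> \<int> \<and> x \<in> int_lattice) \<and>
     (\<exists>k\<in>convex hull K. moment L = weight L *\<^sub>R k)"

lemma weight_simps [simp]: "weight [] = 0" "weight ((w, x) # L) = w + weight L"
    "weight (map (apfst ((*) m)) L) = m * weight L"
  by (induction L) (auto simp: weight_def algebra_simps)

lemma moment_simps [simp]: "moment [] = 0" "moment ((w, x) # L) = w *\<^sub>R x + moment L"
    "moment (map (apfst ((*) m)) L) = m *\<^sub>R moment L"
  by (induction L) (auto simp: moment_def algebra_simps)

lemma weight_nonneg: "(\<And>w x. (w, x) \<in> set L \<Longrightarrow> w > 0) \<Longrightarrow> 0 \<le> weight L"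
  unfolding weight_def by (rule sum_list_nonneg) (auto intro: less_imp_le)

text \<open>
  Pushing makes room for lattice points: the point dividing the segment between two pushed points
  in the ratio of their weights is a lattice point for a suitable \<open>m\<close>.
\<close>

lemma alt_sum_push:
  assumes IH: "\<And>L' K'. \<lbrakk>length L' = Suc (length L); balanced L' K'; finite K'; K' \<subseteq> int_lattice\<rbrakk>
      \<Longrightarrow> alt_sum (map snd L') K' = 0"
    and bal: "balanced ((wx, x) # (wa, a) # L) K" and K: "finite K" "K \<subseteq> int_lattice"
    and m: "m \<in> \<int>" "m \<ge> 1"
  defines "a' \<equiv> x + m *\<^sub>R (a - x)"
  defines "L' \<equiv> (m * wx + (m - 1) * wa, x) # (wa, a') # map (apfst ((*) m)) L"
  shows "balanced L' K" and "alt_sum (map snd L') K = alt_sum (x # a # map snd L) K"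
    and "a' \<in> int_lattice"
proof -
  define S where "S = moment L"
  define W where "W = weight L"
  obtain k where k: "k \<in> convex hull K" "wx *\<^sub>R x + (wa *\<^sub>R a + S) = (wx + (wa + W)) *\<^sub>R k"
    using bal by (auto simp: balanced_def S_def W_def)
  have wpos: "wx > 0" "wx \<in> \<int>" "wa > 0" "wa \<in> \<int>" "x \<in> int_lattice" "a \<in> int_lattice"
    and L: "\<forall>(w, x)\<in>set L. w > 0 \<and> w \<in> \<int> \<and> x \<in> int_lattice"
    using bal by (auto simp: balanced_def)
  have W: "W \<ge> 0" using weight_nonneg[of L] L by (auto simp: W_def)
  show a'_lat: "a' \<in> int_lattice"
    unfolding a'_def using wpos m by (intro int_lattice_add int_lattice_scaleR int_lattice_diff)
  have ints: "m * wx + (m - 1) * wa \<in> \<int>" "wx * m + wa * (m - 1) \<in> \<int>" using wpos m by auto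
  have pos: "m * wx + (m - 1) * wa > 0" using wpos m by (intro add_pos_nonneg) auto
  have Lm: "\<forall>(w, x)\<in>set (map (apfst ((*) c)) L). w > 0 \<and> w \<in> \<int> \<and> x \<in> int_lattice"
    if "c > 0" "c \<in> \<int>" for c
    using L that by (fastforce intro: mult_pos_pos Ints_mult)
  \<comment> \<open>All weights are multiplied by \<open>m\<close>; since m a = a' + (m - 1) x, the
    weight m wa of \<open>a\<close> is divided between \<open>a'\<close> and \<open>x\<close>, and
    the barycentre \<open>k\<close> does not move.\<close>
  have "(m * wx + (m - 1) * wa) *\<^sub>R x + (wa *\<^sub>R a' + m *\<^sub>R S) = m *\<^sub>R (wx *\<^sub>R x + (wa *\<^sub>R a + S))"
    unfolding a'_def by (simp add: algebra_simps)
  also have "\<dots> = (m * wx + (m - 1) * wa + (wa + m * W)) *\<^sub>R k"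
    unfolding k by (simp add: algebra_simps)
  finally show bal': "balanced L' K"
    unfolding balanced_def L'_def using k(1) wpos pos ints a'_lat Lm[of m] m
    by (auto simp: S_def W_def)
  show "alt_sum (map snd L') K = alt_sum (x # a # map snd L) K"
  proof (cases "m = 1")
    case True
    then show ?thesis by (simp add: L'_def a'_def)
  next
    case False
    then have m2: "m > 1" using m by simp
    \<comment> \<open>The relation m a = a' + (m - 1) x also eliminates \<open>x\<close>: the
      barycentre of this shorter list is a convex combination of \<open>a'\<close> and
      \<open>k\<close>, so the list is balanced once \<open>a'\<close> joins
      \<open>K\<close>.\<close>
    let ?L'' = "(m * wx + (m - 1) * wa, a) # map (apfst ((*) (m - 1))) L"
    let ?\<Lambda> = "(m - 1) * (wx + (wa + W))"
    have "(m * wx + (m - 1) * wa) *\<^sub>R a + (m - 1) *\<^sub>R S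
        = wx *\<^sub>R a' + (m - 1) *\<^sub>R (wx *\<^sub>R x + (wa *\<^sub>R a + S))"
      unfolding a'_def by (simp add: algebra_simps)
    also have "\<dots> = wx *\<^sub>R a' + ?\<Lambda> *\<^sub>R k" unfolding k by simp
    also have "\<dots> = (m * wx + (m - 1) * wa + (m - 1) * W) *\<^sub>R
       ((wx / (wx + ?\<Lambda>)) *\<^sub>R a' + (?\<Lambda> / (wx + ?\<Lambda>)) *\<^sub>R k)"
    proof -
      have "m * wx + (m - 1) * wa + (m - 1) * W = wx + ?\<Lambda>" by (simp add: algebra_simps)
      moreover have "wx + ?\<Lambda> > 0" using wpos W m2 by (intro add_pos_nonneg mult_nonneg_nonneg) auto
      ultimately show ?thesis by (simp add: scaleR_add_right)
    qed
    finally have eq: "(m * wx + (m - 1) * wa) *\<^sub>R a + (m - 1) *\<^sub>R S = \<dots>" .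
    have "wx + ?\<Lambda> > 0" "?\<Lambda> \<ge> 0" using wpos W m2 by (auto intro!: add_pos_nonneg mult_nonneg_nonneg)
    then have "(wx / (wx + ?\<Lambda>)) *\<^sub>R a' + (?\<Lambda> / (wx + ?\<Lambda>)) *\<^sub>R k \<in> convex hull insert a' K"
      using wpos k(1) hull_mono[of K "insert a' K"]
      by (intro convexD[OF convex_convex_hull]) (auto simp: hull_inc add_divide_distrib[symmetric])
    moreover have "moment ?L'' = weight ?L'' *\<^sub>R ((wx / (wx + ?\<Lambda>)) *\<^sub>R a' + (?\<Lambda> / (wx + ?\<Lambda>)) *\<^sub>R k)"
      using eq by (simp add: S_def W_def)
    moreover have "\<forall>(w, x)\<in>set ?L''. w > 0 \<and> w \<in> \<int> \<and> x \<in> int_lattice"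
      using Lm[of "m - 1"] wpos pos ints m m2 by auto
    ultimately have "balanced ?L'' (insert a' K)"
      unfolding balanced_def by blast
    then have "alt_sum (map snd ?L'') (insert a' K) = 0"
      using K a'_lat by (intro IH) auto
    then have 1: "alt_sum (a # map snd L) (insert a' K) = 0" by simp
    have "a = (1 - 1 / m) *\<^sub>R x + (1 / m) *\<^sub>R a'"
      using m2 unfolding a'_def by (simp add: algebra_simps)
    then have seg: "a \<in> closed_segment x a'"
      unfolding closed_segment_def using m2 by (intro CollectI exI[of _ "1 / m"]) auto
    have lat: "set (map snd L) \<subseteq> int_lattice" using L by auto
    have "alt_sum (x # a' # map snd L) (insert a K) = 0"
      using K wpos a'_lat lat seg by (intro alt_sum_segment[where b = a]) (auto simp: hull_inc)
    moreover have "alt_sum (map snd L) (insert a' (insert x (insert a K))) = alt_sum (map snd L) (insert a' (insert x K))"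
    proof (rule alt_sum_hull_cong)
      have "a \<in> convex hull insert a' (insert x K)"
        using seg hull_mono[of "{x, a'}" "insert a' (insert x K)"] by (auto simp: segment_convex_hull)
      then show "convex hull insert a' (insert x (insert a K)) = convex hull insert a' (insert x K)"
        by (metis hull_redundant insert_commute)
    qed
    \<comment> \<open>With M for the remaining factors, \<open>1\<close> says a a' M K = a' M K, and
      the segment relation says (1 - x)(1 - a') a M K = 0. Together they give (1 - x) a M K = (1 -
      x) a' M K.\<close>
    ultimately have "alt_sum (x # a # map snd L) K = alt_sum (x # a' # map snd L) K"
      using 1 by (simp add: insert_commute algebra_simps)
    then show ?thesis by (simp add: L'_def)
  qed
qed

text \<open>Induction on the number of points. A single point is redundant in the hull of
  \<open>K\<close> and two points are the segment relation; from three points on, the first one is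
  the centre from which the next two are pushed.\<close>

theorem alt_sum_balanced:
  assumes "balanced L K" "L \<noteq> []" "finite K" "K \<subseteq> int_lattice"
  shows "alt_sum (map snd L) K = 0"
  using assms
proof (induction "length L" arbitrary: L K rule: less_induct)
  case less
  consider wx x where "L = [(wx, x)]" | wx x wa a where "L = [(wx, x), (wa, a)]"
    | wx x w1 a1 w2 a2 M where "L = (wx, x) # (w1, a1) # (w2, a2) # M"
  proof (cases L rule: remdups_adj.cases)
    case (3 p q M)
    then show thesis using that by (cases p; cases q; cases M) auto
  qed (use less.prems(2) that in auto)
  then show ?case
  proof cases
    case 1
    then show ?thesis using less.prems by (auto simp: balanced_def intro!: alt_sum_mem_hull simp del: alt_sum.simps)
  next
    case 2
    then obtain k where k: "k \<in> convex hull K" "wx *\<^sub>R x + wa *\<^sub>R a = (wx + wa) *\<^sub>R k" "wx > 0" "wa > 0"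
      "x \<in> int_lattice" "a \<in> int_lattice"
      using less.prems by (auto simp: balanced_def)
    have "k = (1 / (wx + wa)) *\<^sub>R ((wx + wa) *\<^sub>R k)" using k by simp
    also have "\<dots> = (1 - wa / (wx + wa)) *\<^sub>R x + (wa / (wx + wa)) *\<^sub>R a"
    proof -
      have "1 - wa / (wx + wa) = wx / (wx + wa)" using k by (simp add: field_simps)
      then show ?thesis unfolding k(2)[symmetric] by (simp add: scaleR_add_right)
    qed
    finally have "k \<in> closed_segment x a"
      unfolding closed_segment_def using k by (intro CollectI exI[of _ "wa / (wx + wa)"]) auto
    then show ?thesis using alt_sum_segment[of K x a "[]" k] k less.prems 2 by simp
  next
    case 3
    have bal: "balanced ((wx, x) # (w1, a1) # (w2, a2) # M) K" using less.prems 3 by simp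
    have IH: "alt_sum (map snd L') K' = 0"
      if "length L' = Suc (Suc (length M))" "balanced L' K'" "finite K'" "K' \<subseteq> int_lattice" for L' K'
      using that less.hyps[of L' K'] 3 by force
    \<comment> \<open>The point of the segment from \<open>b2\<close> to \<open>b1\<close> with
      coefficients w2/m and w1/m is to be integral. Pushing both points by m = w1 + w2 cancels these
      denominators.\<close>
    define m where "m = w1 + w2"
    have w: "w1 > 0" "w1 \<in> \<int>" "w2 > 0" "w2 \<in> \<int>" "wx > 0" "wx \<in> \<int>"
      and lat: "x \<in> int_lattice" "a1 \<in> int_lattice" "a2 \<in> int_lattice"
      and M: "\<forall>(w, x)\<in>set M. w > 0 \<and> w \<in> \<int> \<and> x \<in> int_lattice"
      using bal by (auto simp: balanced_def)
    have m_int: "m \<in> \<int>" using w by (simp add: m_def)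
    have m: "m \<ge> 1" using w by (auto simp: m_def Ints_def)
    define b1 where "b1 = x + m *\<^sub>R (a1 - x)"
    define b2 where "b2 = x + m *\<^sub>R (a2 - x)"
    define M1 where "M1 = map (apfst ((*) m)) M"
    define M2 where "M2 = map (apfst ((*) m)) M1"
    define wx1 where "wx1 = m * wx + (m - 1) * w1"
    define wx2 where "wx2 = m * wx1 + (m - 1) * (m * w2)"
    note push1 = alt_sum_push[of "(w2, a2) # M", OF _ bal less.prems(3,4) m_int m, unfolded length_Cons, OF IH]
    have bal1: "balanced ((wx1, x) # (m * w2, a2) # (w1, b1) # M1) K"
      using push1(1) by (auto simp: balanced_def wx1_def b1_def M1_def algebra_simps)
    have eq1: "alt_sum (x # a2 # b1 # map snd M1) K = alt_sum (map snd L) K"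
      using push1(2) 3 by (simp add: b1_def M1_def insert_commute algebra_simps)
    have lat1: "b1 \<in> int_lattice" using push1(3) by (simp add: b1_def)
    note push2 = alt_sum_push[of "(w1, b1) # M1", OF _ bal1 less.prems(3,4) m_int m]
    have len1: "length M1 = length M" by (simp add: M1_def)
    \<comment> \<open>A push keeps the weight of the pushed point and multiplies those of the later
      points by \<open>m\<close>. After both pushes \<open>b1\<close> and \<open>b2\<close>
      therefore have the weights m w1 and m w2, still in the original ratio.\<close>
    have bal2: "balanced ((wx2, x) # (m * w2, b2) # (m * w1, b1) # M2) K"
      using push2(1)[unfolded length_Cons len1, OF IH] by (simp add: wx2_def b2_def M2_def)
    have eq2: "alt_sum (x # b2 # b1 # map snd M2) K = alt_sum (x # a2 # b1 # map snd M1) K"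
      using push2(2)[unfolded length_Cons len1, OF IH] by (simp add: b2_def M2_def)
    have lat2: "b2 \<in> int_lattice" using push2(3)[unfolded length_Cons len1, OF IH] by (simp add: b2_def)
    define b where "b = x + w1 *\<^sub>R (a1 - x) + w2 *\<^sub>R (a2 - x)"
    have lat_b: "b \<in> int_lattice"
      unfolding b_def using w lat by (intro int_lattice_add int_lattice_scaleR int_lattice_diff)
    have mb: "m *\<^sub>R b = w2 *\<^sub>R b2 + w1 *\<^sub>R b1"
      unfolding b_def b1_def b2_def m_def by (simp add: algebra_simps)
    have "b = (1 - w1 / m) *\<^sub>R b2 + (w1 / m) *\<^sub>R b1"
    proof -
      have "b = (1 / m) *\<^sub>R (m *\<^sub>R b)" using m by simp
      also have "\<dots> = (w2 / m) *\<^sub>R b2 + (w1 / m) *\<^sub>R b1" unfolding mb by (simp add: scaleR_add_right)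
      also have "w2 / m = 1 - w1 / m" using m by (simp add: m_def field_simps)
      finally show ?thesis .
    qed
    then have seg: "b \<in> closed_segment b2 b1"
      unfolding closed_segment_def using w m
      by (intro CollectI exI[of _ "w1 / m"]) (auto simp: m_def)
    have "(m * m) *\<^sub>R b = (m * w2) *\<^sub>R b2 + (m * w1) *\<^sub>R b1"
      using arg_cong[OF mb, of "\<lambda>v. m *\<^sub>R v"] by (simp add: scaleR_add_right)
    moreover have "m * m = m * w2 + m * w1" by (simp add: m_def algebra_simps)
    moreover have "m * m > 0" "m * m \<in> \<int>" using m m_int by auto
    ultimately have balb: "balanced ((m * m, b) # (wx2, x) # M2) K"
      using bal2 lat_b by (auto simp: balanced_def algebra_simps)
    have mono: "balanced ((m * m, b) # (wx2, x) # M2) (insert y K)" for y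
      using balb hull_mono[of K "insert y K"] by (fastforce simp: balanced_def)
    let ?M = "x # map snd M2"
    have len2: "length M2 = length M" by (simp add: M1_def M2_def)
    have 0: "alt_sum (b # ?M) K = 0" "alt_sum (b # ?M) (insert b1 K) = 0" "alt_sum (b # ?M) (insert b2 K) = 0"
      using IH[OF _ balb] IH[OF _ mono[of b1]] IH[OF _ mono[of b2]] less.prems lat1 lat2 len2 by simp_all
    have latM: "set ?M \<subseteq> int_lattice" using M lat by (auto simp: M1_def M2_def)
    have s: "alt_sum (b2 # b1 # ?M) (insert b K) = 0"
      using seg lat1 lat2 lat_b less.prems latM by (intro alt_sum_segment[where b = b]) (auto simp: hull_inc)
    have h: "alt_sum ?M (insert b1 (insert b2 (insert b K))) = alt_sum ?M (insert b1 (insert b2 K))"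
    proof (rule alt_sum_hull_cong)
      have "b \<in> convex hull insert b1 (insert b2 K)"
        using seg hull_mono[of "{b2, b1}" "insert b1 (insert b2 K)"] by (auto simp: segment_convex_hull)
      then show "convex hull insert b1 (insert b2 (insert b K)) = convex hull insert b1 (insert b2 K)"
        by (metis hull_redundant insert_commute)
    qed
    \<comment> \<open>The relations for the shorter list with \<open>b\<close> allow
      \<open>b\<close> to be added to the body of each term; the segment relation for
      \<open>b2\<close>, \<open>b1\<close> then applies.\<close>
    have e0: "alt_sum ?M K = alt_sum ?M (insert b K)"
      using 0(1) unfolding alt_sum.simps(2)[of b] by (simp only: right_minus_eq)
    have e1: "alt_sum ?M (insert b1 K) = alt_sum ?M (insert b1 (insert b K))"
      using 0(2) unfolding alt_sum.simps(2)[of b] by (simp only: right_minus_eq insert_commute)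
    have e2: "alt_sum ?M (insert b2 K) = alt_sum ?M (insert b2 (insert b K))"
      using 0(3) unfolding alt_sum.simps(2)[of b] by (simp only: right_minus_eq insert_commute)
    have "alt_sum (b2 # b1 # ?M) K = alt_sum (b2 # b1 # ?M) (insert b K)"
      unfolding alt_sum.simps(2)[of b2] alt_sum.simps(2)[of b1] h e0 e1 e2 ..
    then have "alt_sum (b2 # b1 # ?M) K = 0" using s by simp
    then have "alt_sum (x # b2 # b1 # map snd M2) K = 0"
      by (simp add: insert_commute algebra_simps)
    then show ?thesis using eq1 eq2 by simp
  qed
qed

section \<open>Inclusion-exclusion over circuits\<close>

lemma alt_sum_Pow:
  assumes "distinct xs"
  shows "alt_sum xs K = (\<Sum>S\<in>Pow (set xs). (-1) ^ card S *\<^sub>R Z (convex hull (K \<union> S)))"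
  using assms
proof (induction xs arbitrary: K)
  case (Cons a xs)
  have inj: "inj_on (insert a) (Pow (set xs))"
    using Cons.prems by (intro inj_onI) (auto simp: insert_eq_iff dest: insert_ident)
  have disj: "Pow (set xs) \<inter> insert a ` Pow (set xs) = {}" using Cons.prems by auto
  have "(\<Sum>S\<in>insert a ` Pow (set xs). (-1) ^ card S *\<^sub>R Z (convex hull (K \<union> S)))
      = (\<Sum>S\<in>Pow (set xs). (-1) ^ card (insert a S) *\<^sub>R Z (convex hull (insert a K \<union> S)))"
    using inj by (simp add: sum.reindex)
  also have "\<dots> = (\<Sum>S\<in>Pow (set xs). - ((-1) ^ card S *\<^sub>R Z (convex hull (insert a K \<union> S))))"
  proof (intro sum.cong refl)
    fix S assume "S \<in> Pow (set xs)"
    then have "finite S" "a \<notin> S" using Cons.prems by (auto dest: finite_subset)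
    then show "(-1) ^ card (insert a S) *\<^sub>R Z (convex hull (insert a K \<union> S))
      = - ((-1) ^ card S *\<^sub>R Z (convex hull (insert a K \<union> S)))"
      by simp
  qed
  finally show ?case
    using Cons disj by (simp add: Pow_insert sum.union_disjoint sum_negf)
qed simp

text \<open>
  When \<open>X\<close> is a circuit, this is inclusion-exclusion for the triangulation of its convex hull by the
  simplices \<open>X - {a}\<close> with \<open>c a > 0\<close>.
\<close>

lemma circuit_relation:
  fixes c :: "real^'n \<Rightarrow> real"
  assumes X: "finite X" "X \<subseteq> int_lattice" and c: "\<And>x. x \<in> X \<Longrightarrow> c x \<in> \<int>"
    and sum0: "sum c X = 0" and mom0: "(\<Sum>x\<in>X. c x *\<^sub>R x) = 0"
    and ne: "{x\<in>X. c x > 0} \<noteq> {}"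
  shows "(\<Sum>S\<in>Pow {x\<in>X. c x > 0}. (-1) ^ card S *\<^sub>R Z (convex hull ({x\<in>X. c x \<le> 0} \<union> S))) = 0"
proof -
  define A where "A = {x\<in>X. c x > 0}"
  define K where "K = {x\<in>X. c x \<le> 0}"
  have fin: "finite A" "finite K" and XAK: "X = A \<union> K" "A \<inter> K = {}"
    using X by (auto simp: A_def K_def)
  obtain xs where xs: "set xs = A" "distinct xs" using finite_distinct_list[OF fin(1)] by blast
  define L where "L = map (\<lambda>x. (c x, x)) xs"
  have wt: "weight L = sum c A" and mo: "moment L = (\<Sum>x\<in>A. c x *\<^sub>R x)"
    using xs by (auto simp: L_def weight_def moment_def comp_def sum.distinct_set_conv_list)
  have pos: "sum c A > 0" using ne fin(1) by (intro sum_pos) (auto simp: A_def)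
  have wK: "sum c A = (\<Sum>x\<in>K. - c x)"
    using sum0 fin XAK(2) unfolding XAK(1) by (simp add: sum.union_disjoint sum_negf)
  have mK: "(\<Sum>x\<in>A. c x *\<^sub>R x) = (\<Sum>x\<in>K. - c x *\<^sub>R x)"
    using mom0 fin XAK(2) unfolding XAK(1) by (simp add: sum.union_disjoint sum_negf eq_neg_iff_add_eq_0)
  define k where "k = (\<Sum>x\<in>K. (- c x / sum c A) *\<^sub>R x)"
  have "k \<in> convex hull K"
    unfolding k_def
  proof (rule convex_sum[OF fin(2) convex_convex_hull])
    show "(\<Sum>x\<in>K. - c x / sum c A) = 1"
      unfolding sum_divide_distrib[symmetric] using wK pos by simp
  qed (use pos in \<open>auto simp: K_def hull_inc divide_nonpos_pos\<close>)
  moreover have "moment L = weight L *\<^sub>R k"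
    unfolding mo wt k_def scaleR_sum_right mK using pos by (intro sum.cong) auto
  moreover have "\<forall>(w, x)\<in>set L. w > 0 \<and> w \<in> \<int> \<and> x \<in> int_lattice"
    using xs c X by (auto simp: L_def A_def)
  ultimately have "balanced L K" unfolding balanced_def by blast
  moreover have "L \<noteq> []" using ne xs by (auto simp: L_def A_def)
  moreover have "K \<subseteq> int_lattice" using X by (auto simp: K_def)
  ultimately have "alt_sum (map snd L) K = 0" using fin by (intro alt_sum_balanced)
  moreover have "map snd L = xs" by (simp add: L_def comp_def)
  ultimately show ?thesis using alt_sum_Pow[OF xs(2), of K] xs(1) by (simp add: A_def K_def)
qed

text \<open>Every sign in the circuit relation is invertible, so the term of \<open>S0\<close>
  vanishes together with all the others. The inductions below solve for the polytope in question in
  this way.\<close>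

lemma circuit_isolate:
  fixes c :: "real^'n \<Rightarrow> real"
  assumes "finite X" "X \<subseteq> int_lattice" "\<And>x. x \<in> X \<Longrightarrow> c x \<in> \<int>"
    and "sum c X = 0" "(\<Sum>x\<in>X. c x *\<^sub>R x) = 0" "{x\<in>X. c x > 0} \<noteq> {}"
    and S0: "S0 \<subseteq> X" "{x\<in>X. c x \<le> 0} \<subseteq> S0"
    and other: "\<And>S. \<lbrakk>S \<subseteq> X; {x\<in>X. c x \<le> 0} \<subseteq> S; S \<noteq> S0\<rbrakk> \<Longrightarrow> Z (convex hull S) = 0"
  shows "Z (convex hull S0) = 0"
proof -
  let ?A = "{x\<in>X. c x > 0}" and ?K = "{x\<in>X. c x \<le> 0}"
  let ?f = "\<lambda>S. (-1) ^ card S *\<^sub>R Z (convex hull (?K \<union> S))"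
  have fin: "finite (Pow ?A)" using assms(1) by simp
  have mem: "S0 \<inter> ?A \<in> Pow ?A" by blast
  have U: "?K \<union> (S0 \<inter> ?A) = S0" using S0 by force
  have "0 = sum ?f (Pow ?A)" using circuit_relation[OF assms(1-6)] by simp
  also have "\<dots> = ?f (S0 \<inter> ?A) + sum ?f (Pow ?A - {S0 \<inter> ?A})"
    using fin mem by (rule sum.remove)
  also have "sum ?f (Pow ?A - {S0 \<inter> ?A}) = 0"
  proof (rule sum.neutral, rule ballI)
    fix S assume S: "S \<in> Pow ?A - {S0 \<inter> ?A}"
    have "?K \<union> S \<noteq> S0" using S by force
    then have "Z (convex hull (?K \<union> S)) = 0" using S by (intro other) auto
    then show "?f S = 0" by simp
  qed
  finally have "(-1) ^ card (S0 \<inter> ?A) *\<^sub>R Z (convex hull S0) = 0" unfolding U by simp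
  then show ?thesis by simp
qed

end

section \<open>Reduction to unimodular simplices\<close>

text \<open>
  The columns of \<open>hmat V\<close> are the vertices in homogeneous coordinates, so its determinant is, up to
  sign, the normalized volume of the simplex with vertices \<open>V\<close>. Indexing the vertices by
  \<open>'n option\<close> treats all of them alike.
\<close>

definition hmat :: "('n option \<Rightarrow> real^'n) \<Rightarrow> real^('n option)^('n option)" where
  "hmat V = (\<chi> i j. case i of None \<Rightarrow> 1 | Some k \<Rightarrow> V j $ k)"

definition hvec :: "real^'n \<Rightarrow> real^('n option)" where
  "hvec w = (\<chi> i. case i of None \<Rightarrow> 1 | Some k \<Rightarrow> w $ k)"

lemma hmat_mult_eq_hvec:
  "hmat V *v c = hvec w \<longleftrightarrow> sum (($) c) UNIV = 1 \<and> (\<Sum>j\<in>UNIV. c $ j *\<^sub>R V j) = w"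
proof -
  have "(\<forall>i. P i) \<longleftrightarrow> P None \<and> (\<forall>k. P (Some k))" for P :: "'a option \<Rightarrow> bool"
    by (metis not_None_eq)
  then show ?thesis
    by (simp add: vec_eq_iff matrix_vector_mult_def hmat_def hvec_def mult.commute)
qed

lemma hmat_upd:
  "hmat (V(j := w)) = (\<chi> i l. if l = j then hvec w $ i else hmat V $ i $ l)"
  by (auto simp: hmat_def hvec_def vec_eq_iff split: option.split)

text \<open>Cramer's rule for the homogeneous system: barycentric coordinates are quotients of
  signed volumes. One direction constructs coordinates, the other identifies given ones.\<close>

lemma barycentric_iff:
  assumes "det (hmat V) \<noteq> 0"
  shows "sum c UNIV = 1 \<and> (\<Sum>j\<in>UNIV. c j *\<^sub>R V j) = w
    \<longleftrightarrow> (\<forall>j. c j * det (hmat V) = det (hmat (V(j := w))))"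
proof -
  have "sum c UNIV = 1 \<and> (\<Sum>j\<in>UNIV. c j *\<^sub>R V j) = w \<longleftrightarrow> hmat V *v (\<chi> j. c j) = hvec w"
    unfolding hmat_mult_eq_hvec by simp
  also have "\<dots> \<longleftrightarrow> (\<forall>j. c j = det (hmat (V(j := w))) / det (hmat V))"
    unfolding cramer[OF assms] hmat_upd by (simp add: vec_eq_iff)
  finally show ?thesis using assms by (simp add: field_simps)
qed

lemma det_Ints: "(\<And>i j. A $ i $ j \<in> \<int>) \<Longrightarrow> det (A :: real^'k^'k) \<in> \<int>"
  unfolding det_def by (intro Ints_sum Ints_mult Ints_prod) auto

lemma det_hmat_Ints: "range V \<subseteq> int_lattice \<Longrightarrow> det (hmat V) \<in> \<int>"
  by (rule det_Ints) (auto simp: hmat_def int_lattice_def split: option.split)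

lemma inj_hmat:
  assumes "det (hmat V) \<noteq> 0"
  shows "inj V"
proof (rule injI, rule ccontr)
  fix i j assume ij: "V i = V j" "i \<noteq> j"
  have "(\<Sum>l\<in>UNIV. (if l = k then 1 else 0) *\<^sub>R V l) = V k" for k
    by (simp add: if_distrib if_distribR cong: if_cong)
  then have "(if j = k then 1 else 0) * det (hmat V) = det (hmat (V(j := V k)))" for k
    using barycentric_iff[OF assms, of "\<lambda>l. if l = k then 1 else 0" "V k"] by auto
  from this[of i] this[of j] ij assms show False by simp
qed

text \<open>The integral solutions are the columns of an integral inverse, and two integers with
  product 1 are both 1 or both -1.\<close>

lemma integer_inverse_det:
  fixes A :: "real^'k^'k"
  assumes "\<And>i j. A $ i $ j \<in> \<int>" and "\<And>i. \<exists>x. (\<forall>j. x $ j \<in> \<int>) \<and> A *v x = axis i 1"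
  shows "\<bar>det A\<bar> = 1"
proof -
  obtain x where x: "\<And>i j. x i $ j \<in> \<int>" "\<And>i. A *v x i = axis i 1" using assms(2) by metis
  define B where "B = (\<chi> j i. x i $ j)"
  have "(A ** B) $ i $ j = mat 1 $ i $ j" for i j
    using arg_cong[OF x(2)[of j], of "\<lambda>v. v $ i"]
    by (simp add: matrix_matrix_mult_def matrix_vector_mult_def B_def mat_def axis_def)
  then have "A ** B = mat 1" by (simp add: vec_eq_iff)
  then have d: "det A * det B = 1" by (metis det_I det_mul)
  have "det A \<in> \<int>" "det B \<in> \<int>" using assms(1) x(1) by (auto intro!: det_Ints simp: B_def)
  then obtain a b where "det A = of_int a" "det B = of_int b" by (auto elim!: Ints_cases)
  with d have "a * b = 1" by (metis of_int_eq_1_iff of_int_mult)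
  then have "\<bar>a\<bar> = 1" by (auto simp: zmult_eq_1_iff)
  then show ?thesis using \<open>det A = of_int a\<close> by (metis of_int_1 of_int_abs)
qed

text \<open>If all lattice points had integral barycentric coordinates, \<open>hmat V\<close> would
  have an integral inverse, because \<open>hvec 0\<close> and the differences
  \<open>hvec (axis k 1) - hvec 0\<close> are the unit vectors.\<close>

lemma nonunimodular_point:
  fixes V :: "'n::finite option \<Rightarrow> real^'n"
  assumes V: "range V \<subseteq> int_lattice" and d: "\<bar>det (hmat V)\<bar> \<noteq> 1" "det (hmat V) \<noteq> 0"
  obtains w c where "w \<in> int_lattice" "sum c UNIV = 1" "(\<Sum>j\<in>UNIV. c j *\<^sub>R V j) = w" "\<exists>j. c j \<notin> \<int>"
proof (rule ccontr)
  note obtain_rule = that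
  assume "\<not> thesis"
  then have int: "c j \<in> \<int>" if "w \<in> int_lattice" "sum c UNIV = 1" "(\<Sum>j\<in>UNIV. c j *\<^sub>R V j) = w" for w c j
    using that obtain_rule by blast
  have hv: "\<exists>x. (\<forall>j. x $ j \<in> \<int>) \<and> hmat V *v x = hvec w" if w: "w \<in> int_lattice" for w
  proof -
    define c where "c j = det (hmat (V(j := w))) / det (hmat V)" for j
    have "sum c UNIV = 1 \<and> (\<Sum>j\<in>UNIV. c j *\<^sub>R V j) = w"
      unfolding barycentric_iff[OF d(2)] using d(2) by (simp add: c_def)
    then show ?thesis
      using int[OF w] by (intro exI[of _ "\<chi> j. c j"]) (auto simp: hmat_mult_eq_hvec)
  qed
  obtain y where y: "\<And>w j. w \<in> int_lattice \<Longrightarrow> y w $ j \<in> \<int>" "\<And>w. w \<in> int_lattice \<Longrightarrow> hmat V *v y w = hvec w"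
    using hv by metis
  have "\<bar>det (hmat V)\<bar> = 1"
  proof (rule integer_inverse_det)
    show "hmat V $ i $ j \<in> \<int>" for i j
      using V by (auto simp: hmat_def int_lattice_def split: option.split)
    fix i :: "'n option"
    show "\<exists>x. (\<forall>j. x $ j \<in> \<int>) \<and> hmat V *v x = axis i 1"
    proof (cases i)
      case None
      have "axis None 1 = hvec 0"
        by (auto simp: vec_eq_iff hvec_def axis_def split: option.split)
      then show ?thesis using y[of 0] None by (metis int_lattice_0)
    next
      case (Some k)
      have "hmat V *v (y (axis k 1) - y 0) = hvec (axis k 1) - hvec 0"
        by (simp add: matrix_vector_mult_diff_distrib y)
      also have "\<dots> = axis (Some k) 1"
        by (auto simp: vec_eq_iff hvec_def axis_def split: option.split)
      finally show ?thesis using y(1)[of "axis k 1"] y(1)[of 0] Some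
        by (intro exI[of _ "y (axis k 1) - y 0"]) auto
    qed
  qed
  then show False using d by simp
qed

text \<open>The fractional parts of the coordinates sum to an integer \<open>s\<close> with 1 \<le>
  s \<le> card F. Subtracting 1 from s - 1 of the nonintegral ones restores the sum 1 and keeps all
  absolute values below 1; the total change \<open>e\<close> is integral, so the new point is again
  in the lattice.\<close>

lemma small_barycentric_point:
  fixes V :: "'n::finite option \<Rightarrow> real^'n"
  assumes V: "range V \<subseteq> int_lattice" and d: "\<bar>det (hmat V)\<bar> \<noteq> 1" "det (hmat V) \<noteq> 0"
  obtains u c where "u \<in> int_lattice" "sum c UNIV = 1" "(\<Sum>j\<in>UNIV. c j *\<^sub>R V j) = u" "\<And>j. \<bar>c j\<bar> < 1"
proof -
  obtain w c where w: "w \<in> int_lattice" "sum c UNIV = 1" "(\<Sum>j\<in>UNIV. c j *\<^sub>R V j) = w" "\<exists>j. c j \<notin> \<int>"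
    using nonunimodular_point[OF assms] by blast
  define F where "F = {j. c j \<notin> \<int>}"
  define s where "s = 1 - (\<Sum>j\<in>UNIV. \<lfloor>c j\<rfloor>)"
  have s: "real_of_int s = (\<Sum>j\<in>UNIV. frac (c j))"
    using w(2) by (simp add: s_def frac_def sum_subtractf)
  have frac0: "frac (c j) = 0" if "j \<notin> F" for j using that by (simp add: F_def)
  have "(\<Sum>j\<in>UNIV. frac (c j)) = (\<Sum>j\<in>F. frac (c j))"
    by (rule sum.mono_neutral_right) (auto simp: frac0)
  moreover have "(\<Sum>j\<in>F. frac (c j)) > 0"
    using w(4) by (intro sum_pos) (auto simp: F_def frac_gt_0_iff)
  moreover have "(\<Sum>j\<in>F. frac (c j)) \<le> (\<Sum>j\<in>F. 1)"
    by (intro sum_mono less_imp_le frac_lt_1)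
  ultimately have "0 < s" "s \<le> int (card F)" using s by simp_all
  then have "nat (s - 1) \<le> card F" by simp
  then obtain X where X: "X \<subseteq> F" "card X = nat (s - 1)" using obtain_subset_with_card_n[of "nat (s - 1)" F] by metis
  define e where "e j = (\<lfloor>c j\<rfloor> :: real) + indicator X j" for j
  define c' where "c' j = c j - e j" for j
  have e_int: "e j \<in> \<int>" for j by (simp add: e_def indicator_def)
  have "(\<Sum>j\<in>UNIV. indicator X j) = real (card X)"
    using sum.inter_restrict[of UNIV "\<lambda>_. 1 :: real" X] by (simp add: indicator_def of_bool_def)
  then have sum_e: "sum e UNIV = 0" using X(2) \<open>0 < s\<close> by (simp add: e_def sum.distrib s_def)
  show thesis
  proof (rule that)
    show "w - (\<Sum>j\<in>UNIV. e j *\<^sub>R V j) \<in> int_lattice"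
      using w(1) V e_int by (intro int_lattice_diff int_lattice_sum int_lattice_scaleR) auto
    show "sum c' UNIV = 1" using w(2) sum_e by (simp add: c'_def sum_subtractf)
    show "(\<Sum>j\<in>UNIV. c' j *\<^sub>R V j) = w - (\<Sum>j\<in>UNIV. e j *\<^sub>R V j)"
      using w(3) by (simp add: c'_def scaleR_diff_left sum_subtractf)
    show "\<bar>c' j\<bar> < 1" for j
    proof -
      have c': "c' j = frac (c j) - indicator X j" by (simp add: c'_def e_def frac_def)
      show ?thesis
      proof (cases "j \<in> X")
        case True
        then have "frac (c j) > 0" using X(1) by (auto simp: F_def frac_gt_0_iff)
        then show ?thesis using True frac_lt_1[of "c j"] unfolding c' by simp
      next
        case False
        then show ?thesis using frac_lt_1[of "c j"] frac_ge_0[of "c j"] unfolding c' by simp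
      qed
    qed
  qed
qed

context weak_valuation
begin

text \<open>Exchanging vertex \<open>j\<close> for \<open>u\<close> multiplies the volume by the
  absolute value of \<open>c j\<close>, which is below 1. Induction on the volume settles all faces
  of such simplices, and the circuit formed by \<open>u\<close> and the vertices of \<open>I\<close>
  handles the rest.\<close>

lemma vanishes_on_simplices:
  assumes unimod: "\<And>V I. \<lbrakk>range V \<subseteq> int_lattice; \<bar>det (hmat V)\<bar> = 1\<rbrakk> \<Longrightarrow> Z (convex hull (V ` I)) = 0"
    and "range V \<subseteq> int_lattice" "det (hmat V) \<noteq> 0"
  shows "Z (convex hull (V ` I)) = 0"
  using assms(2,3)
proof (induction "nat \<lfloor>\<bar>det (hmat V)\<bar>\<rfloor>" arbitrary: V I rule: less_induct)
  case less
  note V = less.prems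
  define d where "d = det (hmat V)"
  show ?case
  proof (cases "\<bar>d\<bar> = 1")
    case True
    then show ?thesis using unimod V by (simp add: d_def)
  next
    case False
    then obtain u c where u: "u \<in> int_lattice" and c: "sum c UNIV = 1" "(\<Sum>j\<in>UNIV. c j *\<^sub>R V j) = u"
      and c1: "\<And>j. \<bar>c j\<bar> < 1"
      using small_barycentric_point[OF V(1)] V(2) unfolding d_def by blast
    have cd: "det (hmat (V(j := u))) = c j * d" for j
      using barycentric_iff[OF V(2), of c u] c unfolding d_def by metis
    have injV: "inj V" using V(2) by (rule inj_hmat)
    have IH: "Z (convex hull (V(j := u) ` J)) = 0" if j: "c j \<noteq> 0" for j J
    proof (rule less.hyps)
      show "range (V(j := u)) \<subseteq> int_lattice" using V(1) u by auto
      show "det (hmat (V(j := u))) \<noteq> 0" using cd[of j] j V(2) by (simp add: d_def)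
      have "\<bar>c j * d\<bar> < \<bar>d\<bar>" using c1[of j] V(2) by (simp add: abs_mult d_def)
      moreover have "\<bar>c j * d\<bar> \<in> \<int>" "\<bar>d\<bar> \<in> \<int>"
        using det_hmat_Ints[OF V(1)] det_hmat_Ints[OF \<open>range (V(j := u)) \<subseteq> int_lattice\<close>]
        by (auto simp: cd d_def intro: Ints_abs)
      ultimately show "nat \<lfloor>\<bar>det (hmat (V(j := u)))\<bar>\<rfloor> < nat \<lfloor>\<bar>det (hmat V)\<bar>\<rfloor>"
        unfolding cd d_def[symmetric] by (auto elim!: Ints_cases)
    qed
    have IH_without: "Z (convex hull (V ` J)) = 0" if "c j \<noteq> 0" "j \<notin> J" for j J
    proof -
      have "V(j := u) ` J = V ` J" using that by auto
      then show ?thesis using IH[OF that(1), of J] by simp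
    qed
    have IH_with: "Z (convex hull (insert u (V ` J))) = 0" if "c j \<noteq> 0" "j \<notin> J" for j J
    proof -
      have "V(j := u) ` insert j J = insert u (V ` J)" using that by auto
      then show ?thesis using IH[OF that(1), of "insert j J"] by simp
    qed
    show ?thesis
    \<comment> \<open>A face omitting a vertex \<open>j\<close> with \<open>c j \<noteq> 0\<close>
      is also a face of the smaller simplex in which \<open>u\<close> replaces that vertex.\<close>
    proof (cases "\<exists>j. c j \<noteq> 0 \<and> j \<notin> I")
      case True
      then show ?thesis using IH_without by blast
    next
      case False
      then have supp: "c j = 0" if "j \<notin> I" for j using that by blast
      have c_I: "sum c I = 1" "(\<Sum>j\<in>I. c j *\<^sub>R V j) = u"
        using c supp sum.mono_neutral_right[of UNIV I c] sum.mono_neutral_right[of UNIV I "\<lambda>j. c j *\<^sub>R V j"] by auto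
      have uV: "u \<noteq> V j" for j
      proof
        assume "u = V j"
        then have "V(j := u) = V" by simp
        then have "c j * d = d" using cd[of j] by (simp add: d_def)
        then show False using V(2) c1[of j] by (simp add: d_def)
      qed
      define X where "X = insert u (V ` I)"
      \<comment> \<open>The factor \<bar>d\<bar> clears the denominators given by Cramer's rule; the
        absolute value preserves the signs of the coordinates.\<close>
      define e where "e x = \<bar>d\<bar> * (if x = u then -1 else c (inv V x))" for x
      have eV: "e (V j) = \<bar>d\<bar> * c j" for j using uV[of j] injV by (auto simp: e_def)
      have eu: "e u = - \<bar>d\<bar>" by (simp add: e_def)
      have uX: "u \<notin> V ` I" using uV by auto
      have X: "finite X" "X \<subseteq> int_lattice" using u V(1) by (auto simp: X_def)
      have inj_I: "inj_on V I" using injV inj_on_subset by blast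
      have e_int: "e x \<in> \<int>" if "x \<in> X" for x
      proof -
        have "d \<in> \<int>" "c j * d \<in> \<int>" for j
          using V(1) u unfolding cd[symmetric] unfolding d_def by (auto intro!: det_hmat_Ints)
        then have "e u \<in> \<int>" "e (V j) \<in> \<int>" for j
          unfolding eu eV by (auto simp: abs_if mult.commute)
        then show ?thesis using that by (auto simp: X_def)
      qed
      have sum_e: "sum e X = 0"
        using uX inj_I c_I(1) by (simp add: X_def sum.reindex eV eu flip: sum_distrib_left)
      have "(\<Sum>j\<in>I. (\<bar>d\<bar> * c j) *\<^sub>R V j) = \<bar>d\<bar> *\<^sub>R u"
        unfolding c_I(2)[symmetric] scaleR_sum_right by simp
      then have mom_e: "(\<Sum>x\<in>X. e x *\<^sub>R x) = 0"
        using uX inj_I by (simp add: X_def sum.reindex eV eu)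
      have d0: "\<bar>d\<bar> > 0" using V(2) by (simp add: d_def)
      have sub_u: "\<exists>J\<subseteq>I. S = insert u (V ` J)" if "S \<subseteq> X" "u \<in> S" for S
      proof -
        have "S - {u} \<subseteq> V ` I" using that by (auto simp: X_def)
        then obtain J where "J \<subseteq> I" "S - {u} = V ` J" by (meson subset_image_iff)
        then show ?thesis using that by (intro exI[of _ J]) auto
      qed
      have sub_nu: "\<exists>J\<subseteq>I. S = V ` J" if "S \<subseteq> X" "u \<notin> S" for S
      proof -
        have "S \<subseteq> V ` I" using that by (auto simp: X_def)
        then show ?thesis by (meson subset_image_iff)
      qed
      \<comment> \<open>Here \<open>u\<close> is on the nonpositive side and occurs in every term.
        Each term other than \<open>X\<close> lacks a vertex with positive coordinate and is covered
        by induction.\<close>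
      have full: "Z (convex hull X) = 0"
      proof (rule circuit_isolate[of X e X])
        show "{x \<in> X. 0 < e x} \<noteq> {}"
        proof
          assume "{x \<in> X. 0 < e x} = {}"
          then have "c j \<le> 0" if "j \<in> I" for j
            using that d0 eV[of j] by (auto simp: X_def zero_less_mult_iff)
          then have "sum c I \<le> 0" by (intro sum_nonpos) auto
          then show False using c_I by simp
        qed
        fix S assume S: "S \<subseteq> X" "{x \<in> X. e x \<le> 0} \<subseteq> S" "S \<noteq> X"
        have "u \<in> S" using S(2) d0 by (auto simp: X_def eu)
        then obtain J where J: "J \<subseteq> I" "S = insert u (V ` J)" using sub_u S(1) by blast
        then obtain j where j: "j \<in> I" "j \<notin> J" using S(3) by (auto simp: X_def)
        have "V j \<notin> S" using j J uV injV by (auto dest: injD)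
        moreover have "V j \<in> X" using j by (simp add: X_def)
        ultimately have "\<not> e (V j) \<le> 0" using S(2) by blast
        then have "c j \<noteq> 0" by (auto simp: eV)
        then show "Z (convex hull S) = 0" unfolding J(2) using j by (intro IH_with)
      qed (use X e_int sum_e mom_e in auto)
      show "Z (convex hull (V ` I)) = 0"
      proof (rule circuit_isolate[of X "\<lambda>x. - e x" "V ` I"])
        show "{x \<in> X. 0 < - e x} \<noteq> {}" using d0 by (auto simp: X_def eu)
        show "{x \<in> X. - e x \<le> 0} \<subseteq> V ` I" using d0 by (auto simp: X_def eu)
        fix S assume S: "S \<subseteq> X" "{x \<in> X. - e x \<le> 0} \<subseteq> S" "S \<noteq> V ` I"
        have neg: "c j \<noteq> 0" if "j \<in> I" "V j \<notin> S" for j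
        proof -
          have "V j \<in> X" using that by (simp add: X_def)
          then have "\<not> - e (V j) \<le> 0" using S(2) that(2) by blast
          then show ?thesis by (auto simp: eV)
        qed
        show "Z (convex hull S) = 0"
        proof (cases "u \<in> S")
          case True
          then obtain J where J: "J \<subseteq> I" "S = insert u (V ` J)" using sub_u S(1) by blast
          show ?thesis
          proof (cases "J = I")
            case True
            then show ?thesis using full J by (simp add: X_def)
          next
            case False
            then obtain j where j: "j \<in> I" "j \<notin> J" using J by auto
            have "V j \<notin> S" using j J uV injV by (auto dest: injD)
            then have "c j \<noteq> 0" using neg j by blast
            then show ?thesis unfolding J(2) using j by (intro IH_with)
          qed
        next
          case False
          then obtain J where J: "J \<subseteq> I" "S = V ` J" using sub_nu S(1) by blast
          then obtain j where j: "j \<in> I" "j \<notin> J" using S(3) by auto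
          have "V j \<notin> S" using j J injV by (auto dest: injD)
          then have "c j \<noteq> 0" using neg j by blast
          then show ?thesis unfolding J(2) using j by (intro IH_without)
        qed
      qed (use X e_int sum_e mom_e in \<open>auto simp: X_def sum_negf\<close>)
    qed
  qed
qed

end

section \<open>Affine bases in the lattice and integral dependencies\<close>

lemma affine_basis_det:
  fixes V :: "'n::finite option \<Rightarrow> real^'n"
  assumes "inj V" "\<not> affine_dependent (range V)"
  shows "det (hmat V) \<noteq> 0"
proof
  assume "det (hmat V) = 0"
  then have "\<not> (\<exists>B. B ** hmat V = mat 1)"
    using invertible_det_nz[of "hmat V"] invertible_left_inverse[of "hmat V"] by blast
  then obtain x where x: "hmat V *v x = 0" "x \<noteq> 0"
    using matrix_left_invertible_ker[of "hmat V"] by blast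
  \<comment> \<open>The row \<open>None\<close> of the kernel equation makes the coefficients sum to
    zero, and the other rows make the combination of the vertices vanish: an affine
    dependency.\<close>
  have "sum (($) x) UNIV = 0"
    using arg_cong[OF x(1), of "\<lambda>v. v $ None"] by (simp add: matrix_vector_mult_def hmat_def)
  moreover have "(\<Sum>j\<in>UNIV. x $ j *\<^sub>R V j) = 0"
    unfolding vec_eq_iff
  proof
    fix k show "(\<Sum>j\<in>UNIV. x $ j *\<^sub>R V j) $ k = 0 $ k"
      using arg_cong[OF x(1), of "\<lambda>v. v $ Some k"]
      by (simp add: matrix_vector_mult_def hmat_def mult.commute)
  qed
  moreover have "\<exists>j. x $ j \<noteq> 0" using x(2) by (auto simp: vec_eq_iff)
  ultimately have "affine_dependent (range V)"
    using assms(1)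
    by (subst affine_dependent_explicit_finite)
      (auto intro!: exI[of _ "\<lambda>v. x $ inv V v"] simp: sum.reindex)
  then show False using assms(2) by simp
qed

text \<open>The lattice contains the standard basis and the origin, so it affinely spans the space
  and the missing vertices can be taken from it.\<close>

lemma affine_independent_extend:
  fixes B :: "(real^'n::finite) set"
  assumes "\<not> affine_dependent B" "B \<subseteq> int_lattice"
  obtains V I where "range V \<subseteq> int_lattice" "det (hmat V) \<noteq> 0" "B = V ` I"
proof -
  have full: "affine hull (int_lattice :: (real^'n) set) = UNIV"
  proof -
    have "Basis \<subseteq> (int_lattice :: (real^'n) set)" by (auto simp: Basis_vec_def)
    then have "span Basis \<subseteq> span (int_lattice :: (real^'n) set)" by (rule span_mono)
    then have "span (int_lattice :: (real^'n) set) = UNIV" by (simp add: top.extremum_uniqueI)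
    then show ?thesis by (simp add: affine_hull_span_0 hull_inc)
  qed
  obtain T where T: "\<not> affine_dependent T" "B \<subseteq> T" "T \<subseteq> int_lattice" "affine hull T = UNIV"
    using extend_to_affine_basis[OF assms] full by metis
  have "card T = CARD('n option)"
    using affine_independent_span_eq T aff_dim_affine_independent[OF T(1)] aff_dim_affine_hull[of T] aff_dim_UNIV
    by (simp add: card_option)
  then obtain V where V: "bij_betw V (UNIV :: 'n option set) T"
    using finite_same_card_bij[of "UNIV :: 'n option set" T] aff_independent_finite[OF T(1)] by auto
  show thesis
  proof (rule that)
    show "range V \<subseteq> int_lattice" using V T by (auto simp: bij_betw_def)
    show "det (hmat V) \<noteq> 0" using V T by (intro affine_basis_det) (auto simp: bij_betw_def)
    show "B = V ` (V -` B)" using V T by (auto simp: bij_betw_def)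
  qed
qed

text \<open>A point \<open>v\<close> of \<open>X\<close> outside an affine basis \<open>B\<close> is
  an affine combination of \<open>B\<close>. Cramer's rule in a full lattice simplex containing
  \<open>B\<close> bounds the denominators by \<open>d\<close>; the dependency is scaled to give
  \<open>v\<close> the positive coefficient \<bar>d\<bar>.\<close>

lemma rational_affine_dependency:
  fixes X :: "(real^'n::finite) set"
  assumes dep: "affine_dependent X" and X: "finite X" "X \<subseteq> int_lattice"
  obtains c :: "real^'n \<Rightarrow> real" where "\<And>x. c x \<in> \<int>" "sum c X = 0" "(\<Sum>x\<in>X. c x *\<^sub>R x) = 0" "{x\<in>X. c x > 0} \<noteq> {}"
proof -
  obtain B where B: "B \<subseteq> X" "\<not> affine_dependent B" "affine hull X = affine hull B"
    using affine_basis_exists by blast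
  then have "B \<noteq> X" using dep by auto
  then obtain v where v: "v \<in> X" "v \<notin> B" using B(1) by blast
  obtain V I where V: "range V \<subseteq> int_lattice" "det (hmat V) \<noteq> 0" "B = V ` I"
    using affine_independent_extend[OF B(2)] B(1) X(2) by (metis subset_trans)
  have injV: "inj V" using V(2) by (rule inj_hmat)
  have "v \<in> affine hull B" using v B(3) by (metis hull_inc)
  moreover have finB: "finite B" using B(1) X(1) finite_subset by blast
  ultimately obtain \<mu> where \<mu>: "sum \<mu> B = 1" "(\<Sum>x\<in>B. \<mu> x *\<^sub>R x) = v"
    by (auto simp: affine_hull_finite)
  define d where "d = det (hmat V)"
  define a where "a j = (if j \<in> I then \<mu> (V j) else 0)" for j
  have inj_I: "inj_on V I" using injV inj_on_subset by blast
  have a_I: "sum a I = 1" "(\<Sum>j\<in>I. a j *\<^sub>R V j) = v"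
    using \<mu> inj_I unfolding V(3) by (auto simp: a_def sum.reindex)
  then have a: "sum a UNIV = 1" "(\<Sum>j\<in>UNIV. a j *\<^sub>R V j) = v"
    using sum.mono_neutral_right[of UNIV I a] sum.mono_neutral_right[of UNIV I "\<lambda>j. a j *\<^sub>R V j"]
    by (auto simp: a_def)
  then have ad: "a j * d = det (hmat (V(j := v)))" for j
    using barycentric_iff[OF V(2), of a v] unfolding d_def by blast
  have "v \<in> int_lattice" using v X by blast
  then have ints: "d \<in> \<int>" "a j * d \<in> \<int>" for j
    unfolding ad unfolding d_def using V(1) by (auto intro!: det_hmat_Ints)
  define c where "c x = (if x = v then \<bar>d\<bar> else if x \<in> B then - (\<bar>d\<bar> * a (inv V x)) else 0)" for x
  have cV: "c (V j) = - (\<bar>d\<bar> * a j)" if "j \<in> I" for j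
    using that v(2) injV unfolding c_def V(3) by auto
  have cv: "c v = \<bar>d\<bar>" by (simp add: c_def)
  have vI: "v \<notin> V ` I" using v(2) V(3) by simp
  have sub: "insert v (V ` I) \<subseteq> X" using v B(1) V(3) by auto
  have c0: "c x = 0" if "x \<notin> insert v (V ` I)" for x using that V(3) by (auto simp: c_def)
  show thesis
  proof (rule that[of c])
    show "c x \<in> \<int>" for x
      using ints by (auto simp: c_def abs_if mult.commute)
    have "sum c X = sum c (insert v (V ` I))"
      using X(1) sub c0 by (intro sum.mono_neutral_right) auto
    also have "\<dots> = 0"
      using vI inj_I a_I(1) by (simp add: sum.reindex cV cv sum_negf flip: sum_distrib_left)
    finally show "sum c X = 0" .
    have "(\<Sum>x\<in>X. c x *\<^sub>R x) = (\<Sum>x\<in>insert v (V ` I). c x *\<^sub>R x)"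
      using X(1) sub c0 by (intro sum.mono_neutral_right) auto
    also have "\<dots> = \<bar>d\<bar> *\<^sub>R v - (\<Sum>j\<in>I. (\<bar>d\<bar> * a j) *\<^sub>R V j)"
      using vI inj_I by (simp add: sum.reindex cV cv sum_negf)
    also have "(\<Sum>j\<in>I. (\<bar>d\<bar> * a j) *\<^sub>R V j) = \<bar>d\<bar> *\<^sub>R v"
      unfolding a_I(2)[symmetric] scaleR_sum_right by simp
    finally show "(\<Sum>x\<in>X. c x *\<^sub>R x) = 0" by simp
    show "{x\<in>X. c x > 0} \<noteq> {}" using v(1) cv V(2) by (auto simp: d_def)
  qed
qed

text \<open>Induction on the number of points: for a dependent set, all other terms of a circuit
  relation have fewer points, and an independent set spans a face of a full lattice simplex.\<close>

theorem (in weak_valuation) vanishes_if_vanishes_on_unimodular: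
  assumes unimod: "\<And>V I. \<lbrakk>range V \<subseteq> int_lattice; \<bar>det (hmat V)\<bar> = 1\<rbrakk> \<Longrightarrow> Z (convex hull (V ` I)) = 0"
    and P: "P \<in> lattice_polytopes"
  shows "Z P = 0"
proof -
  have "Z (convex hull X) = 0" if "finite X" "X \<subseteq> int_lattice" for X
    using that
  proof (induction "card X" arbitrary: X rule: less_induct)
    case less
    show ?case
    proof (cases "affine_dependent X")
      case False
      then show ?thesis
        using affine_independent_extend[OF False less.prems(2)] vanishes_on_simplices[OF unimod] by metis
    next
      case True
      then obtain c where c: "\<And>x. c x \<in> \<int>" "sum c X = 0" "(\<Sum>x\<in>X. c x *\<^sub>R x) = 0" "{x\<in>X. c x > 0} \<noteq> {}"
        using rational_affine_dependency less.prems by blast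
      show ?thesis
      proof (rule circuit_isolate[of X c X])
        fix S assume "S \<subseteq> X" "S \<noteq> X"
        then show "Z (convex hull S) = 0"
          using less.prems by (intro less.hyps psubset_card_mono) (auto dest: finite_subset)
      qed (use less.prems c in auto)
    qed
  qed
  then show ?thesis using lattice_polytope_convex_hull[OF P] by metis
qed

section \<open>Equivariance and covariance on standard simplices\<close>

text \<open>The standard simplex \<open>T\<^sub>i\<close> of the overview, where i is the
  cardinality of \<open>J\<close>.\<close>

definition corner_simplex :: "'n set \<Rightarrow> (real^'n) set" where
  "corner_simplex J = convex hull insert 0 ((\<lambda>j. axis j 1) ` J)"

text \<open>An explicit covariance function can be followed through linear combinations, where it
  transforms with the same coefficients.\<close>

definition covariant_with :: "((real^'n) set \<Rightarrow> real^'n) \<Rightarrow> ((real^'n) set \<Rightarrow> real) \<Rightarrow> bool" where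
  "covariant_with Z Z0 \<longleftrightarrow>
     (\<forall>P\<in>lattice_polytopes. \<forall>y\<in>int_lattice. Z ((\<lambda>x. x + y) ` P) = Z P + Z0 P *\<^sub>R y)"

lemma corner_simplex_lattice_polytope [simp]: "corner_simplex J \<in> lattice_polytopes"
  for J :: "'n::finite set"
  unfolding corner_simplex_def by (intro convex_hull_lattice_polytope) auto

lemma affine_image_convex_hull:
  fixes A :: "real^'n^'m"
  shows "(\<lambda>x. A *v x + y) ` (convex hull S) = convex hull ((\<lambda>x. A *v x + y) ` S)"
proof -
  have "(\<lambda>x. A *v x + y) ` T = (+) y ` ((*v) A) ` T" for T
    by (auto simp: image_image add.commute)
  then show ?thesis
    by (simp add: convex_hull_linear_image convex_hull_translation)
qed

lemma affine_image_lattice_polytope: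
  assumes "\<And>i j. A $ i $ j \<in> \<int>" "y \<in> int_lattice" "P \<in> lattice_polytopes"
  shows "(\<lambda>x. A *v x + y) ` P \<in> lattice_polytopes"
proof -
  obtain K where K: "finite K" "K \<subseteq> int_lattice" "P = convex hull K"
    using lattice_polytope_convex_hull assms(3) by blast
  have "A *v x + y \<in> int_lattice" if "x \<in> int_lattice" for x
    using assms that by (auto simp: int_lattice_def matrix_vector_mult_def intro!: Ints_sum)
  then show ?thesis
    unfolding K(3) affine_image_convex_hull using K by (intro convex_hull_lattice_polytope) auto
qed

lemma SL_int_image_lattice_polytope:
  "A \<in> SL_int \<Longrightarrow> P \<in> lattice_polytopes \<Longrightarrow> (\<lambda>x. A *v x) ` P \<in> lattice_polytopes"
  using affine_image_lattice_polytope[of A 0 P] by (simp add: SL_int_def)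

lemma translate_lattice_polytope:
  fixes y :: "real^'n"
  assumes "y \<in> int_lattice" "P \<in> lattice_polytopes"
  shows "(\<lambda>x. x + y) ` P \<in> lattice_polytopes"
proof -
  have "(mat 1 :: real^'n^'n) $ i $ j \<in> \<int>" for i j by (simp add: mat_def)
  from affine_image_lattice_polytope[OF this assms] show ?thesis by simp
qed

text \<open>Cramer's rule gives an integral solution because its denominator is 1.\<close>

lemma SL_int_surj:
  assumes "A \<in> SL_int" "y \<in> int_lattice"
  obtains x where "x \<in> int_lattice" "A *v x = y"
proof -
  have "det A = 1" and int: "\<And>i j. A $ i $ j \<in> \<int>" using assms(1) by (auto simp: SL_int_def)
  then have "A *v (\<chi> k. det (\<chi> i j. if j = k then y $ i else A $ i $ j)) = y"
    using cramer[of A] by simp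
  moreover have "(\<chi> k. det (\<chi> i j. if j = k then y $ i else A $ i $ j)) \<in> int_lattice"
    using int assms(2) by (auto simp: int_lattice_def intro!: det_Ints)
  ultimately show thesis using that by blast
qed

lemma matrix_linear_SL_int:
  fixes f :: "real^'n \<Rightarrow> real^'n"
  assumes "linear f" "\<And>i. f (axis i 1) \<in> int_lattice" "det (matrix f) = 1"
  shows "matrix f \<in> SL_int" "matrix f *v x = f x"
proof -
  show "matrix f \<in> SL_int" using assms by (auto simp: SL_int_def matrix_def int_lattice_def)
  show "matrix f *v x = f x"
    using assms(1) by (simp add: matrix_works linear_matrix_vector_mul_eq)
qed

text \<open>The symmetry says that \<open>A\<close> maps \<open>P\<close> onto P - y, where
  equivariance and covariance evaluate \<open>Z\<close> in two ways.\<close>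

lemma symmetry_equation:
  assumes "SL_int_equivariant Z" "covariant_with Z Z0" "P \<in> lattice_polytopes"
    and "A \<in> SL_int" "y \<in> int_lattice" "(\<lambda>x. A *v x + y) ` P = P"
  shows "A *v Z P = Z P - Z0 P *\<^sub>R y"
proof -
  have "- y \<in> int_lattice" using assms(5) by (simp add: int_lattice_def)
  then have "Z ((\<lambda>x. x + - y) ` P) = Z P + Z0 P *\<^sub>R (- y)"
    using assms(2,3) unfolding covariant_with_def by blast
  moreover have "(\<lambda>x. x + - y) ` P = (\<lambda>x. A *v x) ` P"
    by (subst assms(6)[symmetric]) (simp add: image_image)
  moreover have "Z ((\<lambda>x. A *v x) ` P) = A *v Z P" using assms by (simp add: SL_int_equivariant_def)
  ultimately show ?thesis by simp
qed

lemma corner_simplex_symmetry: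
  fixes f :: "real^'n \<Rightarrow> real^'n"
  assumes "SL_int_equivariant Z" "covariant_with Z Z0"
    and f: "linear f" "\<And>i. f (axis i 1) \<in> int_lattice" "det (matrix f) = 1" and y: "y \<in> int_lattice"
    and perm: "(\<lambda>x. f x + y) ` insert 0 ((\<lambda>j. axis j 1) ` J) = insert 0 ((\<lambda>j. axis j 1) ` J)"
  shows "f (Z (corner_simplex J)) = Z (corner_simplex J) - Z0 (corner_simplex J) *\<^sub>R y"
proof -
  note A = matrix_linear_SL_int[OF f]
  have "(\<lambda>x. matrix f *v x + y) ` corner_simplex J = corner_simplex J"
    unfolding corner_simplex_def affine_image_convex_hull unfolding A(2) perm ..
  from symmetry_equation[OF assms(1,2) _ A(1) y this] show ?thesis by (simp add: A(2))
qed

lemma ex_other_index: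
  assumes "CARD('n::finite) \<ge> 2"
  shows "\<exists>k. k \<noteq> (i :: 'n)"
proof (rule ccontr)
  assume "\<nexists>k. k \<noteq> i"
  then have "UNIV = {i}" by auto
  then have "CARD('n) = card {i}" by metis
  then show False using assms by simp
qed

text \<open>The shear adding coordinate \<open>i\<close> to another coordinate \<open>k\<close>
  fixes the simplex pointwise. It must then fix the value of \<open>Z\<close>, which forces
  coordinate \<open>i\<close> to vanish.\<close>

lemma equivariant_corner_simplex_outside:
  assumes Z: "SL_int_equivariant Z" "covariant_with Z Z0" and n: "CARD('n) \<ge> 2"
    and i: "i \<notin> J"
  shows "Z (corner_simplex J) $ (i :: 'n::finite) = 0"
proof -
  obtain k where k: "k \<noteq> i" using ex_other_index[OF n] by blast
  define f where "f x = (\<chi> r. if r = k then x $ k + x $ i else x $ r)" for x :: "real^'n"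
  have lin: "linear f" by (rule linearI) (auto simp: f_def vec_eq_iff algebra_simps)
  have "matrix f = (\<chi> r. if r = k then row k (mat 1) + 1 *s row i (mat 1) else row r (mat 1))"
    using k by (auto simp: matrix_def f_def vec_eq_iff row_def mat_def axis_def)
  then have "det (matrix f) = 1" using det_row_operation[OF k, of "mat 1" 1] by simp
  moreover have "f (axis j 1) = axis j 1" if "j \<in> J" for j
    using that i by (auto simp: f_def vec_eq_iff axis_def)
  then have "(\<lambda>x. f x + 0) ` insert 0 ((\<lambda>j. axis j 1) ` J) = insert 0 ((\<lambda>j. axis j 1) ` J)"
    using linear_0[OF lin] by (simp add: image_image cong: image_cong)
  ultimately have "f (Z (corner_simplex J)) = Z (corner_simplex J)"
    using corner_simplex_symmetry[OF Z lin, of 0 J]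
    by (force simp: f_def int_lattice_def axis_def)
  from arg_cong[OF this, of "\<lambda>v. v $ k"] show ?thesis by (simp add: f_def)
qed

text \<open>For two or more indices a 3-cycle of vertices is a symmetry of determinant 1. For a
  segment, exchanging the ends has determinant -1, which is corrected by changing the sign of a
  coordinate \<open>l\<close> that is zero on the segment. Coordinate \<open>i\<close> of the
  symmetry equation is the claim.\<close>

lemma equivariant_corner_simplex_inside:
  assumes Z: "SL_int_equivariant Z" "covariant_with Z Z0" and n: "CARD('n) \<ge> 2"
    and i: "i \<in> J"
  shows "Z (corner_simplex J) $ (i :: 'n::finite)
    = Z0 (corner_simplex J) - (\<Sum>j\<in>J. Z (corner_simplex J) $ j)"
proof (cases "J = {i}")
  case True
  obtain l where l: "l \<noteq> i" using ex_other_index[OF n] by blast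
  define f where "f x = (\<chi> r. if r = i \<or> r = l then - x $ r else x $ r)" for x :: "real^'n"
  have lin: "linear f" by (rule linearI) (auto simp: f_def vec_eq_iff algebra_simps)
  have "det (matrix f) = (\<Prod>r\<in>UNIV. matrix f $ r $ r)"
    by (rule det_diagonal) (auto simp: matrix_def f_def axis_def)
  also have "\<dots> = (\<Prod>r\<in>{i, l}. matrix f $ r $ r)"
    by (rule prod.mono_neutral_right) (auto simp: matrix_def f_def axis_def)
  also have "\<dots> = 1" using l by (simp add: matrix_def f_def axis_def)
  finally have det: "det (matrix f) = 1" .
  have "f (axis i 1) + axis i 1 = 0" "f 0 + axis i 1 = axis i 1"
    by (auto simp: f_def vec_eq_iff axis_def)
  then have perm: "(\<lambda>x. f x + axis i 1) ` insert 0 ((\<lambda>j. axis j 1) ` J) = insert 0 ((\<lambda>j. axis j 1) ` J)"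
    using True by auto
  have "f (Z (corner_simplex J)) = Z (corner_simplex J) - Z0 (corner_simplex J) *\<^sub>R axis i 1"
    by (rule corner_simplex_symmetry[OF Z lin _ det _ perm]) (auto simp: f_def int_lattice_def axis_def)
  from arg_cong[OF this, of "\<lambda>v. v $ i"] show ?thesis using True by (simp add: f_def)
next
  case False
  then obtain j where j: "j \<in> J" "j \<noteq> i" using i by blast
  \<comment> \<open>the linear part of the affine map permuting the vertices \<open>0, e\<^sub>i, e\<^sub>j\<close> of the simplex cyclically\<close>
  define f where "f x = (\<chi> r. if r = i then - (\<Sum>k\<in>J. x $ k) else if r = j then x $ i else x $ r)" for x :: "real^'n"
  have lin: "linear f"
    by (rule linearI) (auto simp: f_def vec_eq_iff sum.distrib sum_distrib_left)
  have fin: "finite J" by simp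
  have split: "(\<Sum>k\<in>J. g k) = g i + g j + (\<Sum>k\<in>J - {i} - {j}. g k)" for g :: "'n \<Rightarrow> real"
    using i j by (simp add: sum.remove[of J i] sum.remove[of "J - {i}" j])
  have sum_f: "(\<Sum>k\<in>J. f x $ k) = - x $ j" for x
  proof -
    have "(\<Sum>k\<in>J - {i} - {j}. f x $ k) = (\<Sum>k\<in>J - {i} - {j}. x $ k)"
      by (rule sum.cong) (auto simp: f_def)
    then show ?thesis
      unfolding split[of "\<lambda>k. f x $ k"] using split[of "\<lambda>k. x $ k"] j by (simp add: f_def)
  qed
  have f_comp: "f x $ i = - (\<Sum>k\<in>J. x $ k)" "f x $ j = x $ i" for x
    using j by (auto simp: f_def)
  have f_comp': "f x $ k = x $ k" if "k \<noteq> i" "k \<noteq> j" for x k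
    using that by (auto simp: f_def)
  \<comment> \<open>As a linear map of order three, \<open>f\<close> has a real determinant whose
    cube is 1.\<close>
  have "f (f (f x)) $ k = x $ k" for x k
    by (cases "k = i \<or> k = j") (auto simp: f_comp f_comp' sum_f)
  then have "f (f (f x)) = x" for x by (simp add: vec_eq_iff)
  then have "f \<circ> f \<circ> f = id" by auto
  then have "matrix f ** (matrix f ** matrix f) = mat 1"
    using matrix_compose[OF linear_compose[OF lin lin] lin] matrix_compose[OF lin lin]
    by (simp add: comp_assoc matrix_id_mat_1)
  then have "det (matrix f) ^ 3 = 1" by (metis det_I det_mul mult.assoc power3_eq_cube)
  then have det: "det (matrix f) = 1"
    by (metis odd_numeral odd_real_root_unique power_one)
  have f0: "f 0 + axis i 1 = axis i 1" by (auto simp: f_def vec_eq_iff axis_def)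
  have fi: "f (axis i 1) + axis i 1 = axis j 1"
    using i j by (auto simp: f_def vec_eq_iff axis_def)
  have fj: "f (axis j 1) + axis i 1 = 0"
    using i j by (auto simp: f_def vec_eq_iff axis_def)
  have fk: "f (axis k 1) + axis i 1 = axis k 1" if "k \<in> J" "k \<noteq> i" "k \<noteq> j" for k
    using that by (auto simp: f_def vec_eq_iff axis_def)
  define K where "K = J - {i} - {j}"
  have J: "J = insert i (insert j K)" using i j by (auto simp: K_def)
  have img: "(\<lambda>x. f x + axis i 1) ` ((\<lambda>j. axis j 1) ` K) = (\<lambda>j. axis j 1) ` K"
    unfolding image_image using fk by (intro image_cong) (auto simp: K_def)
  have perm: "(\<lambda>x. f x + axis i 1) ` insert 0 ((\<lambda>j. axis j 1) ` J) = insert 0 ((\<lambda>j. axis j 1) ` J)"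
    unfolding J image_insert img f0 fi fj by blast
  have "f (Z (corner_simplex J)) = Z (corner_simplex J) - Z0 (corner_simplex J) *\<^sub>R axis i 1"
    by (rule corner_simplex_symmetry[OF Z lin _ det _ perm]) (auto simp: f_def int_lattice_def axis_def)
  from arg_cong[OF this, of "\<lambda>v. v $ i"] show ?thesis by (simp add: f_def)
qed

text \<open>All coordinates in \<open>J\<close> equal minus their sum, and summing these equations
  makes that sum zero.\<close>

lemma equivariant_corner_simplex:
  assumes Z: "SL_int_equivariant Z" "covariant_with Z Z0" and n: "CARD('n) \<ge> 2"
    and 0: "Z0 (corner_simplex J) = 0"
  shows "Z (corner_simplex (J :: 'n::finite set)) = 0"
proof -
  let ?v = "Z (corner_simplex J)"
  have v: "?v $ i = - (\<Sum>j\<in>J. ?v $ j)" if "i \<in> J" for i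
    using equivariant_corner_simplex_inside[OF Z n that] 0 by simp
  have "(\<Sum>j\<in>J. ?v $ j) = - (real (card J) * (\<Sum>j\<in>J. ?v $ j))"
    by (subst sum.cong[OF refl v]) auto
  then have "(1 + real (card J)) * (\<Sum>j\<in>J. ?v $ j) = 0" by (simp add: algebra_simps)
  then have "(\<Sum>j\<in>J. ?v $ j) = 0" by (simp add: add_nonneg_eq_0_iff)
  note sum0 = this
  have "?v $ i = 0" for i
  proof (cases "i \<in> J")
    case True
    then show ?thesis using v[OF True] unfolding sum0 by simp
  qed (rule equivariant_corner_simplex_outside[OF Z n])
  then show ?thesis by (simp add: vec_eq_iff)
qed

text \<open>Composition with such a map corrects the determinant when a unimodular simplex has the
  wrong orientation. A coordinate outside \<open>J\<close> can be reflected; if there is none, two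
  basis vectors are exchanged.\<close>

lemma corner_simplex_reflection:
  fixes J :: "'n::finite set"
  assumes n: "CARD('n) \<ge> 2"
  obtains D :: "real^'n^'n" where "\<And>i j. D $ i $ j \<in> \<int>" "det D = -1" "(\<lambda>x. D *v x) ` corner_simplex J = corner_simplex J"
proof (cases "J = UNIV")
  case False
  then obtain l where l: "l \<notin> J" by blast
  define D :: "real^'n^'n" where "D = (\<chi> r s. if r = s then (if r = l then -1 else 1) else 0)"
  have "det D = (\<Prod>r\<in>UNIV. D $ r $ r)" by (rule det_diagonal) (auto simp: D_def)
  also have "\<dots> = (\<Prod>r\<in>{l}. D $ r $ r)" by (rule prod.mono_neutral_right) (auto simp: D_def)
  finally have det: "det D = -1" by (simp add: D_def)
  have De: "D *v axis j 1 = axis j 1" if "j \<in> J" for j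
    unfolding matrix_vector_mult_basis using that l by (auto simp: column_def D_def vec_eq_iff axis_def)
  have "(\<lambda>x. D *v x + 0) ` corner_simplex J = corner_simplex J"
    unfolding corner_simplex_def affine_image_convex_hull using De by (simp add: image_image cong: image_cong)
  then show thesis using that[of D] det by (simp add: D_def)
next
  case True
  obtain i j :: 'n where ij: "i \<noteq> j" using ex_other_index[OF n] by blast
  define p where "p = Transposition.transpose i j"
  define D :: "real^'n^'n" where "D = (\<chi> r. mat 1 $ p r)"
  have "p permutes UNIV" unfolding p_def by (rule permutes_swap_id) auto
  then have "det D = of_int (sign p) * det (mat 1 :: real^'n^'n)"
    unfolding D_def by (rule det_permute_rows)
  then have det: "det D = -1" using ij by (simp add: p_def sign_swap_id)
  have pp: "p (p k) = k" for k by (simp add: p_def)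
  have De: "D *v axis k 1 = axis (p k) 1" for k
    unfolding matrix_vector_mult_basis
    by (auto simp: column_def D_def vec_eq_iff axis_def mat_def pp)
  have "surj p" using pp by (metis surjI)
  have "(\<lambda>x. D *v x) ` range (\<lambda>j. axis j 1) = (\<lambda>j. axis j 1) ` range p"
    unfolding image_image De ..
  then have "(\<lambda>x. D *v x) ` range (\<lambda>j. axis j 1) = range (\<lambda>j. axis j 1)"
    unfolding \<open>surj p\<close> .
  then have "(\<lambda>x. D *v x + 0) ` corner_simplex J = corner_simplex J"
    unfolding corner_simplex_def affine_image_convex_hull True by simp
  then show thesis using that[of D] det by (simp add: D_def mat_def)
qed

section \<open>Unimodular faces as images of standard simplices\<close>

lemma bij_with_image:
  fixes K I :: "'a::finite set"
  assumes "card K = card I"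
  obtains \<sigma> where "bij \<sigma>" "\<sigma> ` K = I"
proof -
  obtain f where f: "bij_betw f K I" using assms finite_same_card_bij[of K I] by auto
  have "card (- K) = card (- I)" using assms by (simp add: Compl_eq_Diff_UNIV card_Diff_subset)
  then obtain g where g: "bij_betw g (- K) (- I)" using finite_same_card_bij[of "- K" "- I"] by auto
  let ?\<sigma> = "\<lambda>x. if x \<in> K then f x else g x"
  have 1: "bij_betw ?\<sigma> K I" using f by (subst bij_betw_cong[of K _ f]) auto
  have 2: "bij_betw ?\<sigma> (- K) (- I)" using g by (subst bij_betw_cong[of "- K" _ g]) auto
  have "bij ?\<sigma>" using bij_betw_combine[OF 1 2] by simp
  moreover have "?\<sigma> ` K = I" using 1 by (simp add: bij_betw_def)
  ultimately show thesis by (rule that)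
qed

text \<open>Renumbering by \<open>\<sigma>\<close> turns the chosen face into the one spanned by
  \<open>None\<close> and \<open>J\<close>. The edge vectors at the vertex \<open>None\<close> form
  \<open>A\<close>, which has an integral inverse since lattice points have integral barycentric
  coordinates with respect to \<open>V\<close>.\<close>

lemma unimodular_face:
  fixes V :: "'n::finite option \<Rightarrow> real^'n"
  assumes n: "CARD('n) \<ge> 2" and V: "range V \<subseteq> int_lattice" "\<bar>det (hmat V)\<bar> = 1"
    and I: "card I = Suc (card J)"
  obtains A y where "A \<in> SL_int" "y \<in> int_lattice" "convex hull (V ` I) = (\<lambda>x. A *v x + y) ` corner_simplex J"
proof -
  have "card (insert None (Some ` J)) = card I"
    using I by (simp add: card_image)
  then obtain \<sigma> where \<sigma>: "bij \<sigma>" "\<sigma> ` insert None (Some ` J) = I"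
    using bij_with_image by blast
  define U where "U k = V (\<sigma> k)" for k
  define A where "A = (\<chi> r s. U (Some s) $ r - U None $ r)"
  define y where "y = U None"
  have U: "U k \<in> int_lattice" for k using V(1) by (auto simp: U_def)
  have A_int: "A $ i $ j \<in> \<int>" for i j using U by (auto simp: A_def int_lattice_def)
  have Ae: "A *v axis s 1 + y = U (Some s)" for s
    by (simp add: matrix_vector_mult_basis column_def A_def y_def vec_eq_iff)
  have "V ` I = U ` insert None (Some ` J)" unfolding \<sigma>(2)[symmetric] image_image U_def ..
  also have "\<dots> = (\<lambda>x. A *v x + y) ` insert 0 ((\<lambda>j. axis j 1) ` J)"
    by (simp add: image_image Ae) (simp add: y_def)
  finally have hull: "convex hull (V ` I) = (\<lambda>x. A *v x + y) ` corner_simplex J"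
    by (simp only: corner_simplex_def affine_image_convex_hull)
  have det0: "det (hmat V) \<noteq> 0" using V(2) by auto
  have "\<bar>det A\<bar> = 1"
  proof (rule integer_inverse_det[OF A_int])
    fix i :: 'n
    define w where "w = y + axis i 1"
    have w: "w \<in> int_lattice" using U by (auto simp: w_def y_def intro: int_lattice_add)
    define c where "c j = det (hmat (V(j := w))) / det (hmat V)" for j
    have "sum c UNIV = 1 \<and> (\<Sum>j\<in>UNIV. c j *\<^sub>R V j) = w"
      unfolding barycentric_iff[OF det0] using det0 by (simp add: c_def)
    then have c: "(\<Sum>j\<in>UNIV. c (\<sigma> j)) = 1" "(\<Sum>j\<in>UNIV. c (\<sigma> j) *\<^sub>R U j) = w"
      using sum.reindex_bij_betw[OF \<sigma>(1), of c] sum.reindex_bij_betw[OF \<sigma>(1), of "\<lambda>j. c j *\<^sub>R V j"]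
      unfolding U_def by simp_all
    have c_int: "c j \<in> \<int>" for j
    proof -
      have "det (hmat (V(j := w))) \<in> \<int>" using V(1) w by (intro det_hmat_Ints) auto
      then show ?thesis using V(2) by (auto simp: c_def abs_if split: if_splits)
    qed
    have "A *v (\<chi> s. c (\<sigma> (Some s))) = (\<Sum>s\<in>UNIV. c (\<sigma> (Some s)) *\<^sub>R (U (Some s) - U None))"
      by (simp add: matrix_vector_mult_def A_def vec_eq_iff mult.commute)
    also have "\<dots> = (\<Sum>j\<in>UNIV. c (\<sigma> j) *\<^sub>R (U j - U None))"
      by (simp add: UNIV_option_conv sum.reindex)
    also have "\<dots> = w - U None"
      using c by (simp add: scaleR_diff_right sum_subtractf flip: scaleR_sum_left)
    finally show "\<exists>x. (\<forall>j. x $ j \<in> \<int>) \<and> A *v x = axis i 1"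
      using c_int by (intro exI[of _ "\<chi> s. c (\<sigma> (Some s))"]) (auto simp: w_def y_def)
  qed
  then consider "det A = 1" | "det A = -1" by linarith
  then show thesis
  proof cases
    case 1
    then show thesis using that[of A y] A_int U hull by (simp add: SL_int_def y_def)
  next
    case 2
    obtain D :: "real^'n^'n" where D: "\<And>i j. D $ i $ j \<in> \<int>" "det D = -1" "(\<lambda>x. D *v x) ` corner_simplex J = corner_simplex J"
      using corner_simplex_reflection[OF n, of J] by blast
    have "det (A ** D) = 1" using 2 D(2) by (simp add: det_mul)
    then have "A ** D \<in> SL_int"
      using D(1) A_int by (auto simp: SL_int_def matrix_matrix_mult_def intro!: Ints_sum)
    moreover have "(\<lambda>x. (A ** D) *v x + y) ` corner_simplex J = (\<lambda>x. A *v x + y) ` (\<lambda>x. D *v x) ` corner_simplex J"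
      by (simp add: image_image matrix_vector_mul_assoc)
    ultimately show thesis using that[of "A ** D" y] U hull D(3) by (simp add: y_def)
  qed
qed

text \<open>A face of a unimodular simplex is an image of any standard simplex of its dimension, so
  one suitable \<open>J\<close> per cardinality suffices.\<close>

theorem vanishes_if_covariance_vanishes:
  fixes Z :: "(real^'n::finite) set \<Rightarrow> real^'n"
  assumes n: "CARD('n) \<ge> 2" and Z: "lattice_valuation Z" "SL_int_equivariant Z" "covariant_with Z Z0"
    and Z0: "\<And>i. i \<le> CARD('n) \<Longrightarrow> \<exists>J :: 'n set. card J = i \<and> Z0 (corner_simplex J) = 0"
    and P: "P \<in> lattice_polytopes"
  shows "Z P = 0"
proof -
  interpret weak_valuation Z
    using Z(1) by unfold_locales (auto simp: lattice_valuation_def)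
  show ?thesis
  proof (rule vanishes_if_vanishes_on_unimodular[OF _ P])
    fix V :: "'n option \<Rightarrow> real^'n" and I assume V: "range V \<subseteq> int_lattice" "\<bar>det (hmat V)\<bar> = 1"
    show "Z (convex hull (V ` I)) = 0"
    proof (cases "I = {}")
      case True
      then show ?thesis using empty by simp
    next
      case False
      have "card I \<le> CARD('n option)" by (rule card_mono) auto
      then have "card I - 1 \<le> CARD('n)" by (simp add: card_option)
      then obtain J :: "'n set" where J: "card J = card I - 1" "Z0 (corner_simplex J) = 0" using Z0 by blast
      then have "card I = Suc (card J)" using False by (simp add: card_gt_0_iff)
      then obtain A y where A: "A \<in> SL_int" "y \<in> int_lattice" "convex hull (V ` I) = (\<lambda>x. A *v x + y) ` corner_simplex J"
        using unimodular_face[OF n V, of I J] by blast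
      \<comment> \<open>Solving A x = y moves the translation in front of \<open>A\<close>, where it
        acts on the standard simplex itself.\<close>
      obtain x where x: "x \<in> int_lattice" "A *v x = y" using SL_int_surj A by blast
      have "convex hull (V ` I) = (\<lambda>x. A *v x) ` (\<lambda>z. z + x) ` corner_simplex J"
        unfolding A(3) image_image by (simp add: matrix_vector_right_distrib x)
      also have "Z \<dots> = A *v Z ((\<lambda>z. z + x) ` corner_simplex J)"
        using Z(2) A(1) translate_lattice_polytope[OF x(1)] by (simp add: SL_int_equivariant_def)
      also have "\<dots> = 0"
        using Z(3) x(1) J(2) equivariant_corner_simplex[OF Z(2,3) n J(2)] by (simp add: covariant_with_def)
      finally show ?thesis .
    qed
  qed
qed

section \<open>Linear combinations of admissible functions\<close>

definition admissible :: "((real^'n) set \<Rightarrow> real^'n) \<Rightarrow> ((real^'n) set \<Rightarrow> real) \<Rightarrow> bool" where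
  "admissible Z Z0 \<longleftrightarrow> lattice_valuation Z \<and> SL_int_equivariant Z \<and> covariant_with Z Z0"

lemma admissible_scale_sum:
  fixes F :: "'i \<Rightarrow> (real^'n) set \<Rightarrow> real^'n"
  assumes "\<And>i. i \<in> I \<Longrightarrow> admissible (F i) (F0 i)"
  shows "admissible (\<lambda>P. \<Sum>i\<in>I. a i *\<^sub>R F i P) (\<lambda>P. \<Sum>i\<in>I. a i * F0 i P)"
proof -
  have empty: "F i {} = 0" if "i \<in> I" for i
    using assms[OF that] by (simp add: admissible_def lattice_valuation_def)
  have val: "F i P + F i Q = F i (P \<union> Q) + F i (P \<inter> Q)"
    if "i \<in> I" "P \<in> lattice_polytopes" "Q \<in> lattice_polytopes" "P \<union> Q \<in> lattice_polytopes" "P \<inter> Q \<in> lattice_polytopes" for i P Q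
    using assms[OF that(1)] that(2-) unfolding admissible_def lattice_valuation_def by blast
  have eqv: "F i ((\<lambda>x. A *v x) ` P) = A *v F i P" if "i \<in> I" "A \<in> SL_int" "P \<in> lattice_polytopes" for i A P
    using assms[OF that(1)] that(2-) unfolding admissible_def SL_int_equivariant_def by blast
  have cov: "F i ((\<lambda>x. x + y) ` P) = F i P + F0 i P *\<^sub>R y" if "i \<in> I" "P \<in> lattice_polytopes" "y \<in> int_lattice" for i P y
    using assms[OF that(1)] that(2-) unfolding admissible_def covariant_with_def by blast
  show ?thesis
    unfolding admissible_def
  proof (intro conjI)
    show "lattice_valuation (\<lambda>P. \<Sum>i\<in>I. a i *\<^sub>R F i P)"
      unfolding lattice_valuation_def
    proof (intro conjI allI impI)
      fix P Q :: "(real^'n) set"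
      assume "P \<in> lattice_polytopes" "Q \<in> lattice_polytopes" "P \<union> Q \<in> lattice_polytopes" "P \<inter> Q \<in> lattice_polytopes"
      then show "(\<Sum>i\<in>I. a i *\<^sub>R F i P) + (\<Sum>i\<in>I. a i *\<^sub>R F i Q)
        = (\<Sum>i\<in>I. a i *\<^sub>R F i (P \<union> Q)) + (\<Sum>i\<in>I. a i *\<^sub>R F i (P \<inter> Q))"
        using val by (simp flip: sum.distrib scaleR_add_right cong: sum.cong)
    qed (simp add: empty)
    show "SL_int_equivariant (\<lambda>P. \<Sum>i\<in>I. a i *\<^sub>R F i P)"
      unfolding SL_int_equivariant_def
      by (simp add: eqv linear_sum[OF matrix_vector_mul_linear] matrix_vector_mult_scaleR cong: sum.cong)
    show "covariant_with (\<lambda>P. \<Sum>i\<in>I. a i *\<^sub>R F i P) (\<lambda>P. \<Sum>i\<in>I. a i * F0 i P)"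
      unfolding covariant_with_def
      by (simp add: cov scaleR_add_right sum.distrib scaleR_sum_left cong: sum.cong)
  qed
qed

lemma admissible_diff:
  assumes "admissible F F0" "admissible G G0"
  shows "admissible (\<lambda>P. F P - G P) (\<lambda>P. F0 P - G0 P)"
proof -
  have "admissible (\<lambda>P. \<Sum>b\<in>UNIV. (if b then 1 else -1) *\<^sub>R (if b then F else G) P)
      (\<lambda>P. \<Sum>b\<in>UNIV. (if b then 1 else -1) * (if b then F0 else G0) P)"
    by (rule admissible_scale_sum) (use assms in auto)
  then show ?thesis by (simp add: UNIV_bool)
qed

lemma empty_lattice_polytope: "{} \<in> lattice_polytopes"
  using convex_hull_lattice_polytope[of "{}"] by simp

lemma admissible_cong:
  fixes F :: "(real^'n::finite) set \<Rightarrow> real^'n"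
  assumes "admissible F F0" "\<And>P. P \<in> lattice_polytopes \<Longrightarrow> G P = F P"
  shows "admissible G F0"
  using assms
  by (auto simp: admissible_def lattice_valuation_def SL_int_equivariant_def covariant_with_def
      empty_lattice_polytope SL_int_image_lattice_polytope translate_lattice_polytope)

lemma admissible_vanishes:
  fixes Z :: "(real^'n::finite) set \<Rightarrow> real^'n"
  assumes "CARD('n) \<ge> 2" "admissible Z Z0"
    and "\<And>i. i \<le> CARD('n) \<Longrightarrow> \<exists>J :: 'n set. card J = i \<and> Z0 (corner_simplex J) = 0"
    and "P \<in> lattice_polytopes"
  shows "Z P = 0"
  using vanishes_if_covariance_vanishes assms unfolding admissible_def by blast

lemma finite_bounded_int_lattice:
  fixes P :: "(real^'n::finite) set"
  assumes "bounded P"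
  shows "finite (P \<inter> int_lattice)"
proof -
  obtain B where B: "\<And>x. x \<in> P \<Longrightarrow> norm x \<le> B" using assms by (auto simp: bounded_iff)
  define S where "S = real_of_int ` {- \<lceil>B\<rceil>..\<lceil>B\<rceil>}"
  have "x \<in> vec_lambda ` (UNIV \<rightarrow>\<^sub>E S)" if x: "x \<in> P" "x \<in> int_lattice" for x
  proof
    have "x $ i \<in> S" for i
    proof -
      obtain m where m: "x $ i = of_int m" using x(2) by (auto simp: int_lattice_def elim: Ints_cases)
      have "\<bar>x $ i\<bar> \<le> B" using component_le_norm_cart[of x i] B[OF x(1)] by linarith
      then show ?thesis unfolding S_def m by (intro imageI) (auto simp: abs_le_iff, linarith+)
    qed
    then show "vec_nth x \<in> UNIV \<rightarrow>\<^sub>E S" by auto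
  qed simp
  then have "P \<inter> int_lattice \<subseteq> vec_lambda ` (UNIV \<rightarrow>\<^sub>E S)" by blast
  moreover have "finite (UNIV \<rightarrow>\<^sub>E S :: ('n \<Rightarrow> real) set)" by (rule finite_PiE) (auto simp: S_def)
  ultimately show ?thesis by (metis finite_imageI finite_subset)
qed

section \<open>The discrete moment vector of dilates\<close>

definition dilated_moment :: "nat \<Rightarrow> (real^'n) set \<Rightarrow> real^'n" where
  "dilated_moment k P = discrete_moment ((\<lambda>x. real k *\<^sub>R x) ` P)"

definition dilated_count :: "nat \<Rightarrow> (real^'n) set \<Rightarrow> nat" where
  "dilated_count k P = card ((\<lambda>x. real k *\<^sub>R x) ` P \<inter> int_lattice)"

lemma finite_dilated:
  fixes P :: "(real^'n::finite) set"
  assumes "P \<in> lattice_polytopes"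
  shows "finite ((\<lambda>x. real k *\<^sub>R x) ` P \<inter> int_lattice)"
  using assms
  by (intro finite_bounded_int_lattice bounded_scaling) (auto simp: lattice_polytopes_def polytope_imp_bounded)

lemma dilated_moment_0 [simp]: "dilated_moment 0 P = 0"
  unfolding dilated_moment_def discrete_moment_def by (intro sum.neutral) auto

text \<open>Translating \<open>P\<close> by \<open>y\<close> moves each lattice point of k P by k y,
  so the covariance function is k times the number of these points.\<close>

lemma admissible_dilated_moment:
  "admissible (dilated_moment k :: (real^'n::finite) set \<Rightarrow> real^'n) (\<lambda>P. real k * real (dilated_count k P))"
  unfolding admissible_def
proof (intro conjI)
  let ?D = "\<lambda>P. (\<lambda>x. real k *\<^sub>R (x :: real^'n)) ` P"
  show "lattice_valuation (dilated_moment k :: (real^'n) set \<Rightarrow> real^'n)"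
    unfolding lattice_valuation_def
  proof (intro conjI allI impI)
    show "dilated_moment k {} = (0 :: real^'n)" by (simp add: dilated_moment_def discrete_moment_def)
    fix P Q :: "(real^'n) set"
    assume lp: "P \<in> lattice_polytopes" "Q \<in> lattice_polytopes"
    show "dilated_moment k P + dilated_moment k Q = dilated_moment k (P \<union> Q) + dilated_moment k (P \<inter> Q)"
    \<comment> \<open>Dilation by 0 is not injective and need not commute with intersections; the
      moment is zero in that case.\<close>
    proof (cases "k = 0")
      case False
      then have "inj (\<lambda>x :: real^'n. real k *\<^sub>R x)" by (auto intro: injI)
      then have "?D (P \<inter> Q) = ?D P \<inter> ?D Q" by (rule image_Int)
      then have "?D (P \<union> Q) \<inter> int_lattice = (?D P \<inter> int_lattice) \<union> (?D Q \<inter> int_lattice)"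
        and "?D (P \<inter> Q) \<inter> int_lattice = (?D P \<inter> int_lattice) \<inter> (?D Q \<inter> int_lattice)" by auto
      then show ?thesis
        unfolding dilated_moment_def discrete_moment_def
        using sum.union_inter[OF finite_dilated[OF lp(1), of k] finite_dilated[OF lp(2), of k], of "\<lambda>x. x"] by simp
    qed simp
  qed
  show "SL_int_equivariant (dilated_moment k :: (real^'n) set \<Rightarrow> real^'n)"
    unfolding SL_int_equivariant_def
  proof (intro ballI)
    fix A :: "real^'n^'n" and P :: "(real^'n) set"
    assume A: "A \<in> SL_int" and P: "P \<in> lattice_polytopes"
    have "invertible A" using A by (simp add: SL_int_def invertible_det_nz)
    then have inj: "inj ((*v) A)" by (metis inj_matrix_vector_mult)
    have lat: "A *v x \<in> int_lattice \<longleftrightarrow> x \<in> int_lattice" for x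
    proof
      assume "A *v x \<in> int_lattice"
      then obtain z where "z \<in> int_lattice" "A *v z = A *v x" using SL_int_surj[OF A] by metis
      then show "x \<in> int_lattice" using inj by (metis injD)
    next
      assume "x \<in> int_lattice"
      then show "A *v x \<in> int_lattice"
        using A by (auto simp: int_lattice_def SL_int_def matrix_vector_mult_def intro!: Ints_sum)
    qed
    have "?D ((*v) A ` P) \<inter> int_lattice = (*v) A ` (?D P \<inter> int_lattice)"
      using lat by (auto simp: image_image matrix_vector_mult_scaleR[symmetric])
    then show "dilated_moment k ((*v) A ` P) = A *v dilated_moment k P"
      unfolding dilated_moment_def discrete_moment_def
      by (simp add: sum.reindex[OF inj_on_subset[OF inj]] linear_sum[OF matrix_vector_mul_linear])
  qed
  show "covariant_with (dilated_moment k :: (real^'n) set \<Rightarrow> real^'n) (\<lambda>P. real k * real (dilated_count k P))"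
    unfolding covariant_with_def
  proof (intro ballI)
    fix P :: "(real^'n) set" and y :: "real^'n"
    assume P: "P \<in> lattice_polytopes" and y: "y \<in> int_lattice"
    define t where "t = real k *\<^sub>R y"
    have t: "t \<in> int_lattice" using y by (simp add: t_def int_lattice_scaleR)
    have lat: "x + t \<in> int_lattice \<longleftrightarrow> x \<in> int_lattice" for x
      using t int_lattice_add[of x t] int_lattice_diff[of "x + t" t] by auto
    have "?D ((\<lambda>x. x + y) ` P) \<inter> int_lattice = (\<lambda>x. x + t) ` (?D P \<inter> int_lattice)"
      using lat by (auto simp: image_image scaleR_add_right t_def)
    then show "dilated_moment k ((\<lambda>x. x + y) ` P) = dilated_moment k P + (real k * real (dilated_count k P)) *\<^sub>R y"
      unfolding dilated_moment_def discrete_moment_def dilated_count_def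
      by (simp add: sum.reindex sum.distrib t_def sum_constant_scaleR mult.commute del: sum_constant)
  qed
qed

section \<open>Lattice points of dilated standard simplices\<close>

lemma card_bounded_sum_functions:
  fixes J :: "'a set"
  assumes "finite J"
  shows "finite {f :: 'a \<Rightarrow> nat. (\<forall>i. i \<notin> J \<longrightarrow> f i = 0) \<and> sum f J \<le> k} \<and>
    card {f :: 'a \<Rightarrow> nat. (\<forall>i. i \<notin> J \<longrightarrow> f i = 0) \<and> sum f J \<le> k} = (k + card J) choose card J"
  using assms
proof (induction J arbitrary: k rule: finite_induct)
  case empty
  have "{f :: 'a \<Rightarrow> nat. \<forall>i. f i = 0} = {\<lambda>_. 0}" by auto
  then show ?case by simp
next
  case (insert a J)
  let ?F = "\<lambda>J k. {f :: 'a \<Rightarrow> nat. (\<forall>i. i \<notin> J \<longrightarrow> f i = 0) \<and> sum f J \<le> k}"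
  show ?case
  proof (induction k)
    case 0
    have "f = (\<lambda>_. 0)" if "f \<in> ?F (insert a J) 0" for f
    proof
      fix i show "f i = 0"
        using that insert.hyps(1) by (cases "i \<in> insert a J") (auto simp: sum_eq_0_iff)
    qed
    then have "?F (insert a J) 0 = {\<lambda>_. 0}" by auto
    then show ?case by simp
  next
    case (Suc k)
    let ?s = "\<lambda>f :: 'a \<Rightarrow> nat. f(a := Suc (f a))"
    have sum_upd: "sum (f(a := m)) (insert a J) = m + sum f J" for f :: "'a \<Rightarrow> nat" and m
      using insert.hyps by (simp add: sum.insert) (intro sum.cong, auto)
    have sum_ins: "sum f (insert a J) = f a + sum f J" for f :: "'a \<Rightarrow> nat"
      using insert.hyps by simp
    \<comment> \<open>The functions are divided according to whether \<open>f a\<close> is zero or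
      positive, which yields Pascal's recurrence.\<close>
    have "?F (insert a J) (Suc k) = ?F J (Suc k) \<union> ?s ` ?F (insert a J) k"
    proof (intro equalityI subsetI)
      fix f assume f: "f \<in> ?F (insert a J) (Suc k)"
      show "f \<in> ?F J (Suc k) \<union> ?s ` ?F (insert a J) k"
      proof (cases "f a")
        case 0
        then have "f i = 0" if "i \<notin> J" for i using f that by (cases "i = a") auto
        then show ?thesis using f 0 by (auto simp: sum_ins)
      next
        case (Suc m)
        then have "f = ?s (f(a := m))" by auto
        moreover have "f(a := m) \<in> ?F (insert a J) k"
          using f Suc unfolding mem_Collect_eq sum_upd by (auto simp: sum_ins)
        ultimately show ?thesis by blast
      qed
    next
      fix f assume "f \<in> ?F J (Suc k) \<union> ?s ` ?F (insert a J) k"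
      then show "f \<in> ?F (insert a J) (Suc k)"
      proof
        assume "f \<in> ?F J (Suc k)"
        then show ?thesis using insert.hyps(2) by (auto simp: sum_ins)
      next
        assume "f \<in> ?s ` ?F (insert a J) k"
        then obtain g where "g \<in> ?F (insert a J) k" "f = ?s g" by blast
        then show ?thesis unfolding mem_Collect_eq using sum_upd[of g "Suc (g a)"] by (auto simp: sum_ins)
      qed
    qed
    moreover have "?F J (Suc k) \<inter> ?s ` ?F (insert a J) k = {}"
      using insert.hyps(2) by (auto simp: fun_eq_iff)
    moreover have "inj ?s" by (rule injI) (metis fun_upd_idem_iff fun_upd_same fun_upd_upd nat.inject)
    then have "card (?s ` ?F (insert a J) k) = card (?F (insert a J) k)"
      by (intro card_image) (rule inj_on_subset, auto)
    ultimately show ?case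
      using insert.IH[of "Suc k"] Suc.IH insert.hyps by (simp add: card_Un_disjoint)
  qed
qed

lemma dilated_corner_simplex:
  "(\<lambda>x. real k *\<^sub>R x) ` corner_simplex J
    = {x. (\<forall>i. 0 \<le> x $ i) \<and> (\<Sum>j\<in>J. x $ j) \<le> real k \<and> (\<forall>i. i \<notin> J \<longrightarrow> x $ i = 0)}" (is "?L = ?R k")
  for J :: "'n::finite set"
proof -
  have ax: "inj_on (\<lambda>j :: 'n. axis j (1 :: real)) J" by (auto simp: inj_on_def axis_eq_axis)
  have "corner_simplex J = {x. (\<forall>i\<in>Basis. 0 \<le> x \<bullet> i) \<and> (\<Sum>i\<in>(\<lambda>j. axis j 1) ` J. x \<bullet> i) \<le> 1 \<and>
      (\<forall>i\<in>Basis. i \<notin> (\<lambda>j. axis j 1) ` J \<longrightarrow> x \<bullet> i = 0)}"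
    unfolding corner_simplex_def by (rule substd_simplex) (auto simp: Basis_vec_def)
  also have "\<dots> = ?R 1"
    using ax by (auto simp: Basis_vec_def sum.reindex inner_axis axis_eq_axis image_iff)
  finally have 1: "corner_simplex J = ?R 1" .
  show ?thesis
  proof (cases "k = 0")
    case True
    have "x = 0" if "x \<in> ?R 0" for x
    proof -
      have "(\<Sum>j\<in>J. x $ j) = 0" using that by (auto intro!: antisym sum_nonneg)
      then have "\<forall>j\<in>J. x $ j = 0" using that by (subst (asm) sum_nonneg_eq_0_iff) auto
      then show ?thesis using that by (auto simp: vec_eq_iff)
    qed
    then have "?R 0 = {0}" by (auto simp del: of_nat_0)
    moreover have "0 \<in> corner_simplex J" unfolding 1 by simp
    ultimately show ?thesis using True by auto
  next
    case False
    then have k: "real k > 0" by simp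
    show ?thesis
    proof (intro equalityI subsetI)
      fix x assume "x \<in> ?L"
      then show "x \<in> ?R k" unfolding 1 using k by (auto simp flip: sum_distrib_left)
    next
      fix x assume x: "x \<in> ?R k"
      have "(1 / real k) *\<^sub>R x \<in> ?R 1" using x k by (auto simp flip: sum_divide_distrib)
      then show "x \<in> ?L" unfolding 1 using k by (intro image_eqI[of _ _ "(1 / real k) *\<^sub>R x"]) auto
    qed
  qed
qed

lemma dilated_count_corner_simplex:
  "dilated_count k (corner_simplex J) = (k + card J) choose card J" for J :: "'n::finite set"
proof -
  let ?F = "{f :: 'n \<Rightarrow> nat. (\<forall>i. i \<notin> J \<longrightarrow> f i = 0) \<and> sum f J \<le> k}"
  let ?g = "\<lambda>f :: 'n \<Rightarrow> nat. (\<chi> i. real (f i))"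
  have "(\<lambda>x. real k *\<^sub>R x) ` corner_simplex J \<inter> int_lattice = ?g ` ?F"
  proof (intro equalityI subsetI)
    fix x assume "x \<in> (\<lambda>x. real k *\<^sub>R x) ` corner_simplex J \<inter> int_lattice"
    then have x: "\<And>i. 0 \<le> x $ i" "(\<Sum>j\<in>J. x $ j) \<le> real k" "\<And>i. i \<notin> J \<Longrightarrow> x $ i = 0" "\<And>i. x $ i \<in> \<int>"
      unfolding dilated_corner_simplex by (auto simp: int_lattice_def)
    then have "x $ i \<in> \<nat>" for i by (simp add: Nats_altdef2)
    then have "\<exists>m. x $ i = real m" for i by (meson Nats_cases)
    then obtain f where f: "\<And>i. x $ i = real (f i)" by metis
    have "x = ?g f" by (simp add: vec_eq_iff f)
    moreover have "f \<in> ?F" using x(2,3) by (auto simp: f simp flip: of_nat_sum)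
    ultimately show "x \<in> ?g ` ?F" by blast
  next
    fix x assume "x \<in> ?g ` ?F"
    then show "x \<in> (\<lambda>x. real k *\<^sub>R x) ` corner_simplex J \<inter> int_lattice"
      unfolding dilated_corner_simplex by (auto simp: int_lattice_def simp flip: of_nat_sum)
  qed
  moreover have "inj ?g" by (rule injI) (auto simp: vec_eq_iff)
  then have "card (?g ` ?F) = card ?F" by (intro card_image) (rule inj_on_subset, auto)
  ultimately show ?thesis
    unfolding dilated_count_def using card_bounded_sum_functions[of J k] by simp
qed

section \<open>Interpolation and triangular systems\<close>

primrec binomial_poly :: "nat \<Rightarrow> real poly" where
  "binomial_poly 0 = 1"
| "binomial_poly (Suc m) = smult (1 / real (Suc m)) (binomial_poly m * [:real (Suc m), 1:])"

lemma poly_binomial_poly: "poly (binomial_poly m) (real k) = real ((k + m) choose m)"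
proof (induction m)
  case (Suc m)
  have "real (Suc m) * real (Suc (k + m) choose Suc m) = real (Suc (k + m)) * real ((k + m) choose m)"
    unfolding of_nat_mult[symmetric] by (simp only: Suc_times_binomial_eq mult.commute)
  then show ?case using Suc by (simp add: field_simps)
qed simp

lemma degree_binomial_poly: "binomial_poly m \<noteq> 0 \<and> degree (binomial_poly m) = m"
proof (induction m)
  case (Suc m)
  then show ?case by (simp add: degree_mult_eq del: mult_pCons_right)
qed simp

text \<open>Lagrange interpolation at 0, ..., N, with basis polynomials \<open>l i\<close>. The
  weights do not depend on \<open>p\<close>, so they can be applied to dilated moments before these
  are known to be polynomial in k.\<close>

lemma coeff_by_values:
  obtains a :: "nat \<Rightarrow> nat \<Rightarrow> real"
    where "\<And>p j. degree p \<le> N \<Longrightarrow> coeff p j = (\<Sum>i\<le>N. a j i * poly p (real i))"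
proof -
  define l where "l i = (\<Prod>m\<in>{..N} - {i}. smult (1 / (real i - real m)) [:- real m, 1:])" for i
  have poly_l: "poly (l i) (real m) = (if i = m then 1 else 0)" if "m \<le> N" for i m
  proof -
    have eq: "poly (l i) (real m) = (\<Prod>m'\<in>{..N} - {i}. (real m - real m') / (real i - real m'))"
      by (simp add: l_def poly_prod diff_divide_distrib)
    show ?thesis
    proof (cases "i = m")
      case True
      then show ?thesis unfolding eq by (auto intro!: prod.neutral)
    next
      case False
      then show ?thesis unfolding eq using that by (auto intro!: prod_zero bexI[of _ m])
    qed
  qed
  have deg_l: "degree (l i) \<le> N" if "i \<le> N" for i
  proof -
    have "degree (l i) \<le> (\<Sum>m\<in>{..N} - {i}. degree (smult (1 / (real i - real m)) [:- real m, 1:]))"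
      unfolding l_def
      using degree_prod_sum_le[of "{..N} - {i}" "\<lambda>m. smult (1 / (real i - real m)) [:- real m, 1:]"]
      by (simp add: comp_def)
    also have "\<dots> \<le> (\<Sum>m\<in>{..N} - {i}. 1)" by (rule sum_mono) (auto simp: degree_smult_eq)
    finally show ?thesis using that by simp
  qed
  have "p = (\<Sum>i\<le>N. smult (poly p (real i)) (l i))" if p: "degree p \<le> N" for p
  proof (rule poly_eqI_degree[of "real ` {..N}"])
    have "degree (\<Sum>i\<le>N. smult (poly p (real i)) (l i)) \<le> N"
      by (rule degree_sum_le) (auto intro: order_trans[OF degree_smult_le] deg_l)
    then show "degree (\<Sum>i\<le>N. smult (poly p (real i)) (l i)) < card (real ` {..N})"
      by (simp add: card_image)
    show "degree p < card (real ` {..N})" using p by (simp add: card_image)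
  qed (auto simp: poly_sum poly_l if_distrib cong: if_cong)
  then have "coeff p j = coeff (\<Sum>i\<le>N. smult (poly p (real i)) (l i)) j" if "degree p \<le> N" for p j
    using that by metis
  then have "coeff p j = (\<Sum>i\<le>N. coeff (l i) j * poly p (real i))" if "degree p \<le> N" for p j
    using that by (simp add: coeff_sum mult.commute)
  then show thesis by (rule that)
qed

text \<open>Row m involves the unknowns 1, ..., m + 1 only, so each new unknown is determined by the
  newest row and leaves the earlier rows unchanged.\<close>

lemma triangular_solution:
  fixes M :: "nat \<Rightarrow> nat \<Rightarrow> real"
  assumes "\<And>m. M m (Suc m) \<noteq> 0" "\<And>m j. j > Suc m \<Longrightarrow> M m j = 0"
  shows "\<exists>c. \<forall>m<K. (\<Sum>j=1..K. c j * M m j) = z m"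
proof (induction K)
  case (Suc K)
  then obtain c where c: "\<And>m. m < K \<Longrightarrow> (\<Sum>j=1..K. c j * M m j) = z m" by blast
  define c' where "c' = c(Suc K := (z K - (\<Sum>j=1..K. c j * M K j)) / M K (Suc K))"
  have "(\<Sum>j=1..K. c' j * M m j) = (\<Sum>j=1..K. c j * M m j)" for m
    by (rule sum.cong) (auto simp: c'_def)
  then have "(\<Sum>j=1..Suc K. c' j * M m j) = z m" if "m < Suc K" for m
    using that c[of m] assms(1)[of K] assms(2)[of m "Suc K"]
    by (cases "m = K") (auto simp: c'_def)
  then show ?case by blast
qed simp

section \<open>Polynomial expansion and classification\<close>

theorem theorem3:
  fixes Z :: "(real^'n) set \<Rightarrow> real^'n"
  assumes "CARD('n) \<ge> 2"
  shows "lattice_valuation Z \<and> SL_int_equivariant Z \<and> translation_covariant Z \<longleftrightarrow>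
    (\<exists>c :: nat \<Rightarrow> real. \<forall>P\<in>lattice_polytopes.
       Z P = (\<Sum>i = 1..CARD('n) + 1. c i *\<^sub>R discrete_moment_coeff i P))"
proof -
  define N where "N = CARD('n) + 1"
  \<comment> \<open>At k this is the covariance number of the k-th dilated moment on a standard
    simplex with \<open>card J = m\<close>. The factor k removes the constant term and raises the
    degree to m + 1.\<close>
  define q where "q m = pCons 0 (binomial_poly m)" for m
  have q_deg: "degree (q m) = Suc m" for m using degree_binomial_poly[of m] by (simp add: q_def)
  have q_lead: "coeff (q m) (Suc m) \<noteq> 0" for m
    using degree_binomial_poly[of m] by (metis leading_coeff_0_iff pCons_eq_0_iff q_def q_deg)
  have q_above: "coeff (q m) j = 0" if "j > Suc m" for m j
    using that q_deg[of m] by (simp add: coeff_eq_0)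
  have q_0: "coeff (q m) 0 = 0" for m by (simp add: q_def)
  have count: "real k * real (dilated_count k (corner_simplex J)) = poly (q (card J)) (real k)"
    for k and J :: "'n set"
    by (simp add: q_def dilated_count_corner_simplex poly_binomial_poly)
  obtain a where a: "\<And>p j. degree p \<le> N \<Longrightarrow> coeff p j = (\<Sum>i\<le>N. a j i * poly p (real i))"
    using coeff_by_values[of N] by blast
  \<comment> \<open>The candidate coefficient is the interpolation formula applied to the dilated
    moments; as a combination of admissible functions it is admissible.\<close>
  define C where "C j P = (\<Sum>i\<le>N. a j i *\<^sub>R dilated_moment i P)" for j and P :: "(real^'n) set"
  define C0 where "C0 j P = (\<Sum>i\<le>N. a j i * (real i * real (dilated_count i P)))" for j and P :: "(real^'n) set"
  have C: "admissible (C j) (C0 j)" for j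
    unfolding C_def C0_def by (rule admissible_scale_sum) (rule admissible_dilated_moment)
  have C0: "C0 j (corner_simplex J) = coeff (q (card J)) j" for j and J :: "'n set"
  proof -
    have "card J \<le> CARD('n)" by (rule card_mono) auto
    then show ?thesis unfolding C0_def count by (subst a) (auto simp: q_deg N_def)
  qed
  have ex_card: "\<exists>J :: 'n set. card J = m" if "m \<le> CARD('n)" for m
    using obtain_subset_with_card_n[of m "UNIV :: 'n set"] that by metis
  have expand: "dilated_moment k P = (\<Sum>j = 1..N. (real k ^ j) *\<^sub>R C j P)"
    if "P \<in> lattice_polytopes" for k and P :: "(real^'n) set"
  proof -
    \<comment> \<open>The error of the expansion is itself admissible, and its covariance vanishes
      on standard simplices, where the covariance of the dilated moments is a polynomial in k of
      degree at most \<open>N\<close>.\<close>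
    let ?W = "\<lambda>P. dilated_moment k P - (\<Sum>j = 1..N. (real k ^ j) *\<^sub>R C j P)"
    let ?V = "\<lambda>P. real k * real (dilated_count k P) - (\<Sum>j = 1..N. (real k ^ j) * C0 j P)"
    have "admissible ?W ?V"
      by (intro admissible_diff admissible_dilated_moment admissible_scale_sum C)
    moreover have "\<exists>J :: 'n set. card J = i \<and> ?V (corner_simplex J) = 0" if "i \<le> CARD('n)" for i
    proof -
      obtain J :: "'n set" where J: "card J = i" using ex_card[OF \<open>i \<le> CARD('n)\<close>] by blast
      have "poly (q i) (real k) = (\<Sum>j\<le>N. coeff (q i) j * real k ^ j)"
        using that by (subst poly_altdef, intro sum.mono_neutral_left) (auto simp: q_deg N_def coeff_eq_0)
      also have "\<dots> = (\<Sum>j = 1..N. (real k ^ j) * coeff (q i) j)"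
        by (rule sum.mono_neutral_cong_right) (auto simp: q_0 not_less_eq_eq)
      finally have "?V (corner_simplex J) = 0" unfolding count C0 J by simp
      then show ?thesis using J by blast
    qed
    ultimately have "?W P = 0" using admissible_vanishes[OF assms] that by blast
    then show ?thesis by simp
  qed
  have unique: "c j = C j P"
    if P: "\<And>k. dilated_moment k P = (\<Sum>j = 1..N. (real k ^ j) *\<^sub>R c j)" and j: "j \<in> {1..N}"
    for c j and P :: "(real^'n) set"
  proof -
    have "c j $ r = C j P $ r" for r
    proof -
      \<comment> \<open>Interpolation recovers the coefficients of this component polynomial from
        the dilated moments alone, so any expansion must agree with \<open>C\<close>.\<close>
      define p where "p = (\<Sum>j = 1..N. monom (c j $ r) j)"
      have "degree p \<le> N"
        unfolding p_def by (rule degree_sum_le) (auto intro: order_trans[OF degree_monom_le])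
      then have "coeff p j = (\<Sum>i\<le>N. a j i * poly p (real i))" by (rule a)
      moreover have "coeff p j = c j $ r" using j by (simp add: p_def coeff_sum)
      moreover have "poly p (real i) = dilated_moment i P $ r" for i
        unfolding P by (simp add: p_def poly_sum poly_monom mult.commute)
      ultimately show ?thesis by (simp add: C_def)
    qed
    then show ?thesis by (simp add: vec_eq_iff)
  qed
  have coeff_C: "discrete_moment_coeff j P = C j P"
    if P: "P \<in> lattice_polytopes" and j: "j \<in> {1..N}" for j and P :: "(real^'n) set"
    unfolding discrete_moment_coeff_def
  proof (rule the_equality)
    show "\<exists>c. (\<forall>k. discrete_moment ((\<lambda>x. real k *\<^sub>R x) ` P) = (\<Sum>j = 1..CARD('n) + 1. (real k ^ j) *\<^sub>R c j)) \<and> C j P = c j"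
      using expand[OF P] by (intro exI[of _ "\<lambda>j. C j P"]) (simp add: dilated_moment_def N_def)
    fix v
    assume "\<exists>c. (\<forall>k. discrete_moment ((\<lambda>x. real k *\<^sub>R x) ` P) = (\<Sum>j = 1..CARD('n) + 1. (real k ^ j) *\<^sub>R c j)) \<and> v = c j"
    then show "v = C j P" using unique[OF _ j] by (auto simp: dilated_moment_def N_def)
  qed
  have iff_C: "(\<forall>P\<in>lattice_polytopes. Z P = (\<Sum>i = 1..CARD('n) + 1. c i *\<^sub>R discrete_moment_coeff i P))
      \<longleftrightarrow> (\<forall>P\<in>lattice_polytopes. Z P = (\<Sum>i = 1..N. c i *\<^sub>R C i P))" for c
    using coeff_C unfolding N_def by (intro ball_cong refl) simp
  show ?thesis
    unfolding iff_C
  proof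
    assume Z: "lattice_valuation Z \<and> SL_int_equivariant Z \<and> translation_covariant Z"
    then obtain Z0 where Z0: "admissible Z Z0"
      by (auto simp: admissible_def translation_covariant_def covariant_with_def)
    obtain J :: "nat \<Rightarrow> 'n set" where J: "\<And>m. m \<le> CARD('n) \<Longrightarrow> card (J m) = m"
      using ex_card by metis
    \<comment> \<open>Since \<open>q m\<close> has degree m + 1, the system is triangular; its
      solution matches the covariance of \<open>Z\<close> on one standard simplex of each
      dimension.\<close>
    obtain c where c: "\<And>m. m < N \<Longrightarrow> (\<Sum>j = 1..N. c j * coeff (q m) j) = Z0 (corner_simplex (J m))"
      using triangular_solution[of "\<lambda>m. coeff (q m)" N "\<lambda>m. Z0 (corner_simplex (J m))"] q_lead q_above by blast
    let ?W = "\<lambda>P. Z P - (\<Sum>j = 1..N. c j *\<^sub>R C j P)"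
    let ?V = "\<lambda>P. Z0 P - (\<Sum>j = 1..N. c j * C0 j P)"
    have "admissible ?W ?V" by (intro admissible_diff Z0 admissible_scale_sum C)
    moreover have "card (J i) = i \<and> ?V (corner_simplex (J i)) = 0" if "i \<le> CARD('n)" for i
      unfolding C0 J[OF that] using c[of i] that by (simp add: N_def)
    ultimately have "?W P = 0" if "P \<in> lattice_polytopes" for P
      using admissible_vanishes[OF assms] that by blast
    then show "\<exists>c. \<forall>P\<in>lattice_polytopes. Z P = (\<Sum>i = 1..N. c i *\<^sub>R C i P)"
      by (intro exI[of _ c]) simp
  next
    assume "\<exists>c. \<forall>P\<in>lattice_polytopes. Z P = (\<Sum>i = 1..N. c i *\<^sub>R C i P)"
    then obtain c where c: "\<And>P. P \<in> lattice_polytopes \<Longrightarrow> Z P = (\<Sum>i = 1..N. c i *\<^sub>R C i P)" by blast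
    have "admissible Z (\<lambda>P. \<Sum>i = 1..N. c i * C0 i P)"
      by (rule admissible_cong[OF admissible_scale_sum c]) (rule C)
    then show "lattice_valuation Z \<and> SL_int_equivariant Z \<and> translation_covariant Z"
      by (auto simp: admissible_def translation_covariant_def covariant_with_def)
  qed
qed

end
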